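(* Let $\ell\ge1$, $\underline\lambda\in\mathbb R^{\ell+1}$ and $s\in\mathbb C$ with $\mathrm{Im}\,s<0$. The elementary $\mathfrak{gl}_{\ell+1}$-Whittaker function satisfies, for all $\underline x\in\mathbb R^{\ell+1}$, $$i^{\ell+1}\int_{\mathbb R^{\ell+1}}\mathcal Q^{(0)}(\underline x,\underline y\,|\,s)\,\Psi^{(0)}_{\underline\lambda}(\underline y)\,\prod_{j=1}^{\ell+1}dy_j=L^{(0)}(s,\underline\lambda)\,\Psi^{(0)}_{\underline\lambda}(\underline x),\qquad L^{(0)}(s,\underline\lambda)=\prod_{j=1}^{\ell+1}\frac1{s-\lambda_j}.$$
   Context: $i=\sqrt{-1}$; $\Theta(x)=1$ for $x\ge0$ and $\Theta(x)=0$ for $x<0$. The elementary Baxter operator has kernel $$\mathcal Q^{(0)}(\underline x,\underline y\,|\,s)=e^{\,i s\sum_{j=1}^{\ell+1}(x_j-y_j)}\;\Theta(y_{\ell+1}-x_{\ell+1})\prod_{j=1}^{\ell}\Theta(y_j-x_j)\,\Theta(x_j-y_{j+1}).$$ The elementary $\mathfrak{gl}_{\ell+1}$-Whittaker function is, for $\underline\lambda,\underline x\in\mathbb R^{\ell+1}$, $$\Psi^{(0)}_{\underline\lambda}(\underline x)= i^{-\ell(\ell+1)/2}\int_{\mathcal S}\prod_{n=1}^{\ell}\frac{\prod_{s\ne p}(\gamma_{n,s}-\gamma_{n,p})}{n!\prod_{k=1}^n\prod_{m=1}^{n+1}(\gamma_{n,k}-\gamma_{n+1,m})}\; e^{i\sum_{n=1}^{\ell+1}\sum_{j=1}^n(\gamma_{n,j}-\gamma_{n-1,j})x_n}\prod_{n=1}^\ell\prod_{j=1}^n\frac{d\gamma_{n,j}}{2\pi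 i},$$ where (in this formula only) $(s,p)$ runs over ordered pairs of distinct indices in $\{1,\dots,n\}$, $\gamma_{\ell+1,j}:=\lambda_j$, $\gamma_{n,j}:=0$ for $j>n$, and $\mathcal S$ means that each $\gamma_{n,j}$ ($1\le j\le n\le\ell$) runs over a horizontal line $\mathbb R-i\varepsilon_{n,j}$ with fixed real $\varepsilon_{n,j}$ chosen so that $\max_j\mathrm{Im}\,\gamma_{k,j}<\min_m\mathrm{Im}\,\gamma_{k+1,m}$ for $k=1,\dots,\ell$. *)

theory Defs
  imports "HOL-Analysis.Analysis"
begin

text \<open>
  A vector of R^N is a function \<open>x :: nat \<Rightarrow> real\<close> of which only the coordinates
  \<open>x 1, \<dots>, x N\<close> are used; integration over R^N is with respect to the product measure
  of \<open>lborel\<close> over the index set \<open>{1..N}\<close>. The parameter \<open>l\<close> is the rank, so that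
  the group is GL(l+1).
\<close>

definition Theta :: "real \<Rightarrow> real" where
  "Theta x = (if 0 \<le> x then 1 else 0)"

definition Q0 :: "nat \<Rightarrow> (nat \<Rightarrow> real) \<Rightarrow> (nat \<Rightarrow> real) \<Rightarrow> complex \<Rightarrow> complex" where
  "Q0 l x y s =
     exp (\<i> * s * (\<Sum>j=1..l+1. of_real (x j - y j)))
     * of_real (Theta (y (l+1) - x (l+1)))
     * (\<Prod>j=1..l. of_real (Theta (y j - x j)) * of_real (Theta (x j - y (j+1))))"

definition L0 :: "nat \<Rightarrow> complex \<Rightarrow> (nat \<Rightarrow> real) \<Rightarrow> complex" where
  "L0 l s lam = (\<Prod>j=1..l+1. 1 / (s - of_real (lam j)))"

text \<open>
  For \<open>1 \<le> j \<le> n \<le> l\<close> the variable \<open>\<gamma> n j\<close> runs over the horizontal line of height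
  \<open>- eps n j\<close>, parametrised from left to right by its real part \<open>t (n, j)\<close>. The top row
  \<open>n = l + 1\<close> is \<open>lam\<close>, and entries outside the triangle (in particular row 0) vanish.
\<close>

definition gam ::
  "nat \<Rightarrow> (nat \<Rightarrow> real) \<Rightarrow> (nat \<Rightarrow> nat \<Rightarrow> real) \<Rightarrow> (nat \<times> nat \<Rightarrow> real) \<Rightarrow> nat \<Rightarrow> nat \<Rightarrow> complex" where
  "gam l lam eps t n j =
     (if j < 1 \<or> n < j then 0
      else if n = l + 1 then of_real (lam j)
      else of_real (t (n, j)) - \<i> * of_real (eps n j))"

text \<open>The heights of the lines do not depend on the real parts \<open>t\<close>.\<close>

definition admissible :: "nat \<Rightarrow> (nat \<Rightarrow> real) \<Rightarrow> (nat \<Rightarrow> nat \<Rightarrow> real) \<Rightarrow> bool" where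
  "admissible l lam eps \<longleftrightarrow>
     (\<forall>t. \<forall>k\<in>{1..l}.
        Max ((\<lambda>j. Im (gam l lam eps t k j)) ` {1..k})
        < Min ((\<lambda>m. Im (gam l lam eps t (k+1) m)) ` {1..k+1}))"

definition Psi0_integrand ::
  "nat \<Rightarrow> (nat \<Rightarrow> real) \<Rightarrow> (nat \<Rightarrow> nat \<Rightarrow> complex) \<Rightarrow> complex" where
  "Psi0_integrand l x \<gamma> =
     (\<Prod>n=1..l. (\<Prod>s\<in>{1..n}. \<Prod>p\<in>{1..n} - {s}. \<gamma> n s - \<gamma> n p)
                 / (fact n * (\<Prod>k=1..n. \<Prod>m=1..n+1. \<gamma> n k - \<gamma> (n+1) m)))
     * exp (\<i> * (\<Sum>n=1..l+1. \<Sum>j=1..n. (\<gamma> n j - \<gamma> (n-1) j) * of_real (x n)))"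

text \<open>The product of the factors \<open>1 / (2 \<pi> \<i>)\<close> comes from the measure
  \<open>d\<gamma> / (2 \<pi> \<i>)\<close> in each variable.\<close>

definition Psi0 ::
  "nat \<Rightarrow> (nat \<Rightarrow> nat \<Rightarrow> real) \<Rightarrow> (nat \<Rightarrow> real) \<Rightarrow> (nat \<Rightarrow> real) \<Rightarrow> complex" where
  "Psi0 l eps lam x =
     \<i> powi (- int (l * (l + 1) div 2))
     * (\<integral>t. Psi0_integrand l x (gam l lam eps t)
             * (\<Prod>n=1..l. \<Prod>j=1..n. 1 / (2 * of_real pi * \<i>))
          \<partial>(\<Pi>\<^sub>M q\<in>(SIGMA n:{1..l}. {1..n}). lborel))"

end

theory Submission
  imports
    Defs
    "HOL-Probability.Characteristic_Functions"
    "HOL-Probability.Sinc_Integral"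
    "Jordan_Normal_Form.Determinant"
begin

text \<open>
  The elementary Whittaker function has a closed form: up to a factor that does not depend on \<open>x\<close>,
  it is the function which vanishes outside the chamber \<open>x\<^sub>1 \<ge> \<dots> \<ge> x\<^sub>l\<^sub>+\<^sub>1\<close> and equals
  \<open>det (h\<^sub>j(x\<^sub>b))\<close> inside (lemma \<open>Psi0_eq_exp_dd_det\<close>). Here \<open>h\<^sub>j\<close> is, up to a power of \<open>\<i>\<close>, the
  divided difference of \<open>\<lambda> \<mapsto> e^(\<i> \<lambda> x)\<close> at \<open>\<lambda>\<^sub>1, \<dots>, \<lambda>\<^sub>j\<^sub>+\<^sub>1\<close> (function \<open>exp_dd\<close>). For distinct
  \<open>\<lambda>\<close> the determinant is proportional to \<open>det (e^(\<i> \<lambda>\<^sub>a x\<^sub>b))\<close>; with divided differences it makes sense for all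
  \<open>\<lambda>\<close>, and the \<open>h\<^sub>j\<close> satisfy the triangular system \<open>h\<^sub>j' = \<i> \<lambda>\<^sub>j\<^sub>+\<^sub>1 h\<^sub>j + h\<^sub>j\<^sub>-\<^sub>1\<close>.
  
  Given the closed form, the eigenvalue equation is linear algebra. As a function of \<open>y\<close> the Baxter
  kernel is a product of exponentials \<open>e^(\<i> s (x\<^sub>b - y\<^sub>b))\<close> restricted to the intervals
  \<open>x\<^sub>b \<le> y\<^sub>b \<le> x\<^sub>b\<^sub>-\<^sub>1\<close>, without an upper bound for \<open>b = 1\<close>. Hence the integral of the determinant is a
  determinant of differences of tails \<open>G\<^sub>j(x) = \<integral>\<^sub>x\<^sup>\<infinity> e^(-\<i> s y) h\<^sub>j(y) dy\<close>, and row operations leave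
  \<open>det (G\<^sub>j(x\<^sub>b))\<close>. Integrating the differential equations gives
  \<open>\<i> (s - \<lambda>\<^sub>j\<^sub>+\<^sub>1) G\<^sub>j(x) = e^(-\<i> s x) h\<^sub>j(x) + G\<^sub>j\<^sub>-\<^sub>1(x)\<close>, a triangular relation whose diagonal
  yields the factor \<open>L0\<close> (lemma \<open>baxter_integral_exp_dd_det\<close>).
  
  The closed form is proved by induction on the number of rows of the triangular array, with
  arbitrary complex numbers above the integration lines as the top row (lemmas \<open>row_integral\<close> and
  \<open>integral_Psi0_integrand\<close>). The integral over one row splits by Andreief's identity into
  integrals over single lines, and each of these is a Fourier inversion of the Laplace transform
  \<open>G\<^sub>j(0) = \<Prod>\<^sub>m 1 / (\<i> (s - \<lambda>\<^sub>m))\<close>. The heights of the lines drop out, so no contour has to be moved.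
  
  The absolute value of the integrand depends on \<open>x\<close> only through a constant factor. If the
  multiple integral did not converge absolutely, it would therefore do so for no \<open>x\<close>, and the
  function would be 0 by the convention for Lebesgue integrals; the identity holds in either case.
\<close>

section \<open>Divided differences of the exponential function\<close>

lemma has_vector_derivative_primitive:
  fixes f :: "real \<Rightarrow> complex"
  assumes "continuous_on UNIV f"
  shows "((\<lambda>u. LBINT t=0..u. f t) has_vector_derivative f x) (at x)"
proof -
  let ?a = "-\<bar>x\<bar> - 1" and ?b = "\<bar>x\<bar> + 1"
  have "((\<lambda>u. LBINT t=ereal 0..u. f t) has_vector_derivative f x) (at x within {?a..?b})"
    by (rule interval_integral_FTC2) (use assms continuous_on_subset in auto)
  moreover have "at x within {?a..?b} = at x"
    by (rule at_within_interior) auto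
  ultimately show ?thesis by (simp add: zero_ereal_def)
qed

text \<open>
  Up to the factor \<open>\<i> ^ j\<close>, \<open>exp_dd w j x\<close> is the divided difference of
  \<open>\<lambda> \<mapsto> e^(\<i> \<lambda> x)\<close> at the nodes \<open>w 0, \<dots>, w j\<close>. Building it up by convolutions,
  one node at a time, avoids the denominators \<open>w a - w b\<close> and so also covers coinciding nodes.
\<close>

fun exp_dd :: "(nat \<Rightarrow> complex) \<Rightarrow> nat \<Rightarrow> real \<Rightarrow> complex" where
  "exp_dd w 0 x = exp (\<i> * w 0 * of_real x)"
| "exp_dd w (Suc j) x =
     exp (\<i> * w (Suc j) * of_real x) *
     (LBINT t=0..x. exp (- \<i> * w (Suc j) * of_real t) * exp_dd w j t)"

lemma has_vector_derivative_exp_i: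
  "((\<lambda>x. exp (\<i> * w * of_real x)) has_vector_derivative \<i> * w * exp (\<i> * w * of_real x)) (at x within S)"
  by (rule has_vector_derivative_real_field) (auto intro!: derivative_eq_intros)

lemma exp_dd_ode_0:
  "(exp_dd w 0 has_vector_derivative \<i> * w 0 * exp_dd w 0 x) (at x within S)"
proof -
  have "exp_dd w 0 = (\<lambda>x. exp (\<i> * w 0 * of_real x))" by (rule ext) simp
  then show ?thesis using has_vector_derivative_exp_i[of "w 0" x S] by simp
qed

text \<open>
  As functions of \<open>x\<close> the divided differences solve a bidiagonal linear system of differential
  equations. The later facts about them are read off from this system. Continuity of each
  function is what makes the next one differentiable, hence the joint induction.
\<close>

lemma exp_dd_continuous_ode:
  "continuous_on UNIV (exp_dd w j) \<and>
   (\<forall>x S. (exp_dd w (Suc j) has_vector_derivative \<i> * w (Suc j) * exp_dd w (Suc j) x + exp_dd w j x) (at x within S))"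
proof (induction j)
  have step: "\<forall>x S. (exp_dd w (Suc j) has_vector_derivative \<i> * w (Suc j) * exp_dd w (Suc j) x + exp_dd w j x) (at x within S)"
    if "continuous_on UNIV (exp_dd w j)" for j
  proof (intro allI)
    fix x S
    let ?f = "\<lambda>t. exp (- \<i> * w (Suc j) * of_real t) * exp_dd w j t"
    have "continuous_on UNIV ?f" by (intro continuous_intros that)
    from has_vector_derivative_primitive[OF this, of x]
    have "((\<lambda>u. LBINT t=0..u. ?f t) has_vector_derivative ?f x) (at x within S)"
      by (rule has_vector_derivative_at_within)
    note has_vector_derivative_mult[OF has_vector_derivative_exp_i[of "w (Suc j)" x S] this]
    then show "(exp_dd w (Suc j) has_vector_derivative \<i> * w (Suc j) * exp_dd w (Suc j) x + exp_dd w j x) (at x within S)"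
      by (simp add: exp_dd.simps(2)[abs_def] algebra_simps flip: exp_add)
  qed
  case 0
  have "continuous_on UNIV (exp_dd w 0)"
    by (rule continuous_on_vector_derivative) (rule exp_dd_ode_0)
  with step show ?case by blast
  case (Suc j)
  then have "continuous_on UNIV (exp_dd w (Suc j))"
    by (intro continuous_on_vector_derivative) blast
  with step show ?case by blast
qed

lemmas continuous_exp_dd = conjunct1[OF exp_dd_continuous_ode]
lemmas exp_dd_ode = conjunct2[OF exp_dd_continuous_ode, rule_format]

lemma exp_dd_at_0: "exp_dd w j 0 = (if j = 0 then 1 else 0)"
  by (cases j) (auto simp: zero_ereal_def)

lemma linear_ode_unique:
  fixes f g :: "real \<Rightarrow> complex"
  assumes "\<And>x. (f has_vector_derivative a * f x + h x) (at x)"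
    and "\<And>x. (g has_vector_derivative a * g x + h x) (at x)"
    and "f 0 = g 0"
  shows "f x = g x"
proof -
  let ?e = "\<lambda>x. exp (\<i> * (\<i> * a) * of_real x)"
  have "((\<lambda>x. ?e x * (f x - g x)) has_vector_derivative
      (?e x * ((a * f x + h x) - (a * g x + h x)) + (\<i> * (\<i> * a) * ?e x) * (f x - g x))) (at x)" for x
    by (intro has_vector_derivative_mult has_vector_derivative_exp_i has_vector_derivative_diff assms)
  then have "((\<lambda>x. ?e x * (f x - g x)) has_vector_derivative 0) (at x within UNIV)" for x
    by (simp add: algebra_simps)
  from has_vector_derivative_zero_constant[OF convex_UNIV this]
  obtain c where c: "\<And>x. ?e x * (f x - g x) = c" by auto
  from c[of 0] assms(3) have "c = 0" by simp
  with c[of x] show ?thesis by simp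
qed

text \<open>
  This is Newton interpolation of \<open>\<lambda> \<mapsto> e^(\<i> \<lambda> x)\<close> evaluated at one of its own nodes, where
  the sum breaks off. Both sides solve \<open>f' = \<i> w\<^sub>k f\<close> with \<open>f 0 = 1\<close>. Read as a matrix identity
  in \<open>k\<close> and \<open>j\<close>, the coefficients form a triangular matrix whose determinant is a Vandermonde
  product.
\<close>

lemma exp_eq_sum_exp_dd:
  assumes "k < n"
  shows "exp (\<i> * w k * of_real x) = (\<Sum>j<n. (\<Prod>m<j. \<i> * (w k - w m)) * exp_dd w j x)"
proof -
  let ?c = "\<lambda>j. \<Prod>m<j. \<i> * (w k - w m)"
  let ?F = "\<lambda>n x. \<Sum>j<n. ?c j * exp_dd w j x"
  \<comment> \<open>Differentiating the sum telescopes: multiplying each term by \<open>\<i> w\<^sub>k\<close> instead of its own \<open>\<i> w\<^sub>j\<close> costs exactly the next term.\<close>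
  have A: "(?F n has_vector_derivative \<i> * w k * ?F n x - ?c n * (if n = 0 then 0 else exp_dd w (n-1) x)) (at x)" for n x
  proof (induction n)
    case (Suc n)
    show ?case
    proof (cases n)
      case 0
      have "((\<lambda>x. exp_dd w 0 x) has_vector_derivative \<i> * w 0 * exp_dd w 0 x) (at x)"
        by (rule exp_dd_ode_0)
      with 0 show ?thesis by (simp add: algebra_simps)
    next
      case (Suc p)
      show ?thesis
        using has_vector_derivative_add[OF Suc.IH has_vector_derivative_mult_right[OF exp_dd_ode[of w p x UNIV], of "?c (Suc p)"]]
        unfolding Suc by (simp add: algebra_simps)
    qed
  qed simp
  have "?c n = 0" using assms by auto
  have D: "(?F n has_vector_derivative \<i> * w k * ?F n x + 0) (at x)" for x
    using A[of n x] unfolding \<open>?c n = 0\<close> by simp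
  have "?F n 0 = (\<Sum>j<n. if j = 0 then 1 else 0)"
    by (intro sum.cong) (auto simp: exp_dd_at_0)
  also have "\<dots> = 1" using assms by (simp add: sum.delta)
  finally have "?F n 0 = 1" .
  show ?thesis
  proof (rule linear_ode_unique[of "\<lambda>x. exp (\<i> * w k * of_real x)" "\<i> * w k" "\<lambda>_. 0" "?F n"])
    show "((\<lambda>x. exp (\<i> * w k * of_real x)) has_vector_derivative
        \<i> * w k * exp (\<i> * w k * of_real y) + 0) (at y)" for y
      using has_vector_derivative_exp_i[of "w k" y UNIV] by simp
  qed (use \<open>?F n 0 = 1\<close> D in simp_all)
qed

text \<open>
  The Leibniz rule for divided differences of the product \<open>e^(\<i> \<lambda> x) e^(\<i> \<lambda> c)\<close>. The last node
  only occurs in the second factor, so both sides solve the same differential equation in \<open>c\<close>.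
  A translation of \<open>x\<close> therefore acts on the family of divided differences by a triangular matrix.
\<close>

lemma exp_dd_add:
  "exp_dd w j (x + c) = (\<Sum>k\<le>j. exp_dd w k x * exp_dd (\<lambda>m. w (k + m)) (j - k) c)"
proof (induction j arbitrary: c)
  case 0
  show ?case by (simp add: algebra_simps flip: exp_add)
next
  case (Suc j)
  let ?a = "\<i> * w (Suc j)"
  let ?R = "\<lambda>c. \<Sum>k\<le>Suc j. exp_dd w k x * exp_dd (\<lambda>m. w (k + m)) (Suc j - k) c"
  have L: "((\<lambda>c. exp_dd w (Suc j) (x + c)) has_vector_derivative
      ?a * exp_dd w (Suc j) (x + c) + exp_dd w j (x + c)) (at c)" for c
  proof -
    have "((exp_dd w (Suc j) \<circ> (\<lambda>c. x + c)) has_vector_derivative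
        1 *\<^sub>R (?a * exp_dd w (Suc j) (x + c) + exp_dd w j (x + c))) (at c)"
      by (intro vector_diff_chain_at exp_dd_ode) (auto intro!: derivative_eq_intros)
    then show ?thesis by (simp add: o_def)
  qed
  have R: "(?R has_vector_derivative ?a * ?R c + exp_dd w j (x + c)) (at c)" for c
  proof -
    have "((\<lambda>c. exp_dd w k x * exp_dd (\<lambda>m. w (k + m)) (Suc j - k) c) has_vector_derivative
       exp_dd w k x * (\<i> * w (Suc j) * exp_dd (\<lambda>m. w (k + m)) (Suc j - k) c +
         exp_dd (\<lambda>m. w (k + m)) (j - k) c)) (at c)" if "k \<le> j" for k
      using exp_dd_ode[of "\<lambda>m. w (k + m)" "j - k" c UNIV] that
      by (intro has_vector_derivative_mult_right) (simp add: Suc_diff_le del: exp_dd.simps)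
    moreover have "((\<lambda>c. exp_dd w (Suc j) x * exp_dd (\<lambda>m. w (Suc j + m)) (Suc j - Suc j) c) has_vector_derivative
       exp_dd w (Suc j) x * (\<i> * w (Suc j) * exp_dd (\<lambda>m. w (Suc j + m)) 0 c)) (at c)"
      using has_vector_derivative_exp_i[of "w (Suc j)" c UNIV]
      by (intro has_vector_derivative_mult_right) simp
    ultimately have "(?R has_vector_derivative
       (\<Sum>k\<le>j. exp_dd w k x * (\<i> * w (Suc j) * exp_dd (\<lambda>m. w (k + m)) (Suc j - k) c +
         exp_dd (\<lambda>m. w (k + m)) (j - k) c)) +
       exp_dd w (Suc j) x * (\<i> * w (Suc j) * exp_dd (\<lambda>m. w (Suc j + m)) 0 c)) (at c)"
      unfolding sum.atMost_Suc
      by (intro has_vector_derivative_add has_vector_derivative_sum) auto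
    then show ?thesis
      unfolding Suc.IH[of c] by (simp add: sum.distrib sum_distrib_left algebra_simps del: exp_dd.simps)
  qed
  have "?R 0 = (\<Sum>k\<le>Suc j. if k = Suc j then exp_dd w (Suc j) x else 0)"
    by (intro sum.cong) (auto simp: exp_dd_at_0 simp del: exp_dd.simps)
  then have "exp_dd w (Suc j) (x + 0) = ?R 0" by (simp add: sum.delta del: exp_dd.simps)
  with L R show ?case by (rule linear_ode_unique)
qed

lemma exp_dd_bound:
  assumes "\<And>m. m \<le> j \<Longrightarrow> - \<beta> \<le> Im (w m)" and "0 \<le> x"
  shows "norm (exp_dd w j x) \<le> x ^ j * exp (\<beta> * x)"
  using assms
proof (induction j arbitrary: x)
  case 0
  from "0.prems"(1)[of 0] "0.prems"(2) have "- Im (w 0) * x \<le> \<beta> * x"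
    by (intro mult_right_mono) auto
  then show ?case by simp
next
  case (Suc j)
  let ?a = "Im (w (Suc j))"
  \<comment> \<open>Removing the last exponential leaves a function whose derivative only involves the previous divided difference; the mean value inequality then does the induction step.\<close>
  let ?K = "\<lambda>t. exp (\<i> * (- w (Suc j)) * of_real t) * exp_dd w (Suc j) t"
  have a: "0 \<le> ?a + \<beta>" using Suc.prems(1)[of "Suc j"] by simp
  have D: "(?K has_vector_derivative exp (\<i> * (- w (Suc j)) * of_real t) * exp_dd w j t) (at t within {0..x})" for t
    using has_vector_derivative_mult[OF has_vector_derivative_exp_i[of "- w (Suc j)" t] exp_dd_ode[of w j t]]
    by (simp add: algebra_simps del: exp_dd.simps)
  have "norm (?K x - ?K 0) \<le> (x ^ j * exp ((?a + \<beta>) * x)) * norm (x - 0)"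
  proof (rule differentiable_bound[of "{0..x}" ?K "\<lambda>t h. h *\<^sub>R (exp (\<i> * (- w (Suc j)) * of_real t) * exp_dd w j t)"])
    fix t assume t: "t \<in> {0..x}"
    show "(?K has_derivative (\<lambda>h. h *\<^sub>R (exp (\<i> * (- w (Suc j)) * of_real t) * exp_dd w j t))) (at t within {0..x})"
      using D unfolding has_vector_derivative_def .
    have "norm (exp (\<i> * (- w (Suc j)) * of_real t) * exp_dd w j t) \<le> exp (?a * t) * (t ^ j * exp (\<beta> * t))"
      unfolding norm_mult by (intro mult_mono Suc.IH) (use t Suc.prems in auto)
    also have "\<dots> = t ^ j * exp ((?a + \<beta>) * t)" by (simp add: algebra_simps exp_add)
    also have "\<dots> \<le> x ^ j * exp ((?a + \<beta>) * x)"
      using a t by (intro mult_mono power_mono) (auto intro: mult_left_mono)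
    finally have "norm (exp (\<i> * (- w (Suc j)) * of_real t) * exp_dd w j t) \<le> x ^ j * exp ((?a + \<beta>) * x)" .
    then show "onorm (\<lambda>h. h *\<^sub>R (exp (\<i> * (- w (Suc j)) * of_real t) * exp_dd w j t)) \<le> x ^ j * exp ((?a + \<beta>) * x)"
      using Suc.prems by (intro onorm_bound) (auto simp: mult.commute intro: mult_left_mono)
  qed (use Suc.prems in auto)
  then have "exp (?a * x) * norm (exp_dd w (Suc j) x) \<le> x ^ Suc j * exp ((?a + \<beta>) * x)"
    using Suc.prems(2) by (simp add: exp_dd_at_0 norm_mult algebra_simps del: exp_dd.simps)
  also have "\<dots> = exp (?a * x) * (x ^ Suc j * exp (\<beta> * x))"
    by (simp add: algebra_simps exp_add)
  finally show ?case
    by (simp del: exp_dd.simps)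
qed

section \<open>Laplace transforms and tail integrals\<close>

lemma integrable_pow_exp_atLeast_0:
  assumes "\<beta> < (0::real)"
  shows "set_integrable lborel {0..} (\<lambda>x. x ^ j * exp (\<beta> * x))"
proof -
  have "set_integrable lborel {0..} (\<lambda>x::real. x ^ j * exp (- x))"
  proof -
    have "integrable lborel (\<lambda>x::real. (x ^ j * exp (- x)) * indicator {0..} x)"
    proof (rule integrableI_nn_integral_finite)
      have "(\<integral>\<^sup>+x. ennreal ((x::real) ^ j * exp (- x) * indicator {0..} x) \<partial>lborel) =
          (\<integral>\<^sup>+x. ennreal (x ^ j * exp (- x)) * indicator {0..} x \<partial>lborel)"
        by (intro nn_integral_cong) (simp split: split_indicator)
      also have "\<dots> = ennreal (fact j)"
        by (simp add: nn_intergal_power_times_exp_Ici)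
      finally show "(\<integral>\<^sup>+x. ennreal (x ^ j * exp (- x) * indicator {0..} x) \<partial>lborel) = ennreal (fact j)" .
    qed (auto split: split_indicator)
    then show ?thesis by (simp add: set_integrable_def mult.commute)
  qed
  then have "integrable lborel (\<lambda>x. indicator {0..} (0 + -\<beta> * x) *\<^sub>R ((0 + -\<beta> * x) ^ j * exp (- (0 + -\<beta> * x))))"
    unfolding set_integrable_def
    by (subst lborel_integrable_real_affine_iff) (use assms in auto)
  then have "integrable lborel (\<lambda>x. (1 / (-\<beta>) ^ j) *\<^sub>R (indicator {0..} (0 + -\<beta> * x) *\<^sub>R ((0 + -\<beta> * x) ^ j * exp (- (0 + -\<beta> * x)))))"
    by (rule integrable_scaleR_right)
  moreover have "(1 / (-\<beta>) ^ j) *\<^sub>R (indicator {0..} (0 + -\<beta> * x) *\<^sub>R ((0 + -\<beta> * x) ^ j * exp (- (0 + -\<beta> * x))))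
     = indicator {0..} x *\<^sub>R (x ^ j * exp (\<beta> * x))" for x
    using assms power_mult_distrib[of "-\<beta>" x j]
    by (auto simp: indicator_def mult_le_0_iff zero_le_mult_iff)
  ultimately show ?thesis by (simp add: set_integrable_def)
qed

text \<open>
  For \<open>x = 0\<close> these tails are Laplace transforms of the divided differences; for general \<open>x\<close>
  they are the antiderivatives from which the integral against the Baxter kernel is assembled.
\<close>

definition exp_dd_tail :: "(nat \<Rightarrow> complex) \<Rightarrow> complex \<Rightarrow> nat \<Rightarrow> real \<Rightarrow> complex" where
  "exp_dd_tail w s j x = (LINT y:{x..}|lborel. exp (- \<i> * s * of_real y) * exp_dd w j y)"

lemma set_integrable_exp_dd_atLeast_0:
  assumes "\<And>m. m \<le> j \<Longrightarrow> Im s < Im (w m)"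
  shows "set_integrable lborel {0..} (\<lambda>y. exp (- \<i> * s * of_real y) * exp_dd w j y)"
proof -
  define \<mu> where "\<mu> = Min ((\<lambda>m. Im (w m)) ` {..j})"
  have \<mu>: "Im s < \<mu>" "\<And>m. m \<le> j \<Longrightarrow> \<mu> \<le> Im (w m)"
    unfolding \<mu>_def using assms by auto
  show ?thesis
  proof (rule set_integrable_bound)
    show "set_integrable lborel {0..} (\<lambda>x. x ^ j * exp ((Im s - \<mu>) * x))"
      using \<mu> by (intro integrable_pow_exp_atLeast_0) simp
    have "continuous_on {0..} (\<lambda>y. exp (- \<i> * s * of_real y) * exp_dd w j y)"
      by (intro continuous_intros continuous_on_subset[OF continuous_exp_dd]) simp
    then show "set_borel_measurable lborel {0..} (\<lambda>y. exp (- \<i> * s * of_real y) * exp_dd w j y)"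
      unfolding set_borel_measurable_def
      by (simp add: borel_measurable_continuous_on_indicator)
    show "AE y in lborel. y \<in> {0..} \<longrightarrow>
       norm (exp (- \<i> * s * of_real y) * exp_dd w j y) \<le> norm (y ^ j * exp ((Im s - \<mu>) * y))"
    proof (intro AE_I2 impI)
      fix y :: real assume y: "y \<in> {0..}"
      have "norm (exp_dd w j y) \<le> y ^ j * exp (- \<mu> * y)"
        using y \<mu> by (intro exp_dd_bound) auto
      then have "exp (Im s * y) * norm (exp_dd w j y) \<le> exp (Im s * y) * (y ^ j * exp (- \<mu> * y))"
        by (rule mult_left_mono) simp
      also have "\<dots> = y ^ j * exp ((Im s - \<mu>) * y)"
        by (simp add: algebra_simps flip: exp_add)
      finally show "norm (exp (- \<i> * s * of_real y) * exp_dd w j y) \<le> norm (y ^ j * exp ((Im s - \<mu>) * y))"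
        using y by (simp add: norm_mult)
    qed
  qed
qed

lemma set_integrable_exp_dd:
  assumes "\<And>m. m \<le> j \<Longrightarrow> Im s < Im (w m)"
  shows "set_integrable lborel {x..} (\<lambda>y. exp (- \<i> * s * of_real y) * exp_dd w j y)"
proof -
  have "set_integrable lborel {min x 0..0} (\<lambda>y. exp (- \<i> * s * of_real y) * exp_dd w j y)"
    by (intro borel_integrable_atLeastAtMost' continuous_intros continuous_on_subset[OF continuous_exp_dd]) simp
  from set_integrable_Un[OF this set_integrable_exp_dd_atLeast_0[OF assms]]
  show ?thesis
    by (rule set_integrable_subset) auto
qed

lemma exp_dd_tendsto_0:
  assumes "\<And>m. m \<le> j \<Longrightarrow> Im s < Im (w m)"
  shows "((\<lambda>y. exp (- \<i> * s * of_real y) * exp_dd w j y) \<longlongrightarrow> 0) at_top"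
proof -
  define \<mu> where "\<mu> = Min ((\<lambda>m. Im (w m)) ` {..j})"
  have \<mu>: "Im s < \<mu>" "\<And>m. m \<le> j \<Longrightarrow> \<mu> \<le> Im (w m)"
    unfolding \<mu>_def using assms by auto
  have "((\<lambda>y::real. y ^ j * exp ((Im s - \<mu>) * y)) \<longlongrightarrow> 0) at_top"
  proof -
    let ?c = "\<mu> - Im s"
    have c: "0 < ?c" using \<mu> by simp
    have "((\<lambda>y. (?c * y) ^ j / exp (?c * y)) \<longlongrightarrow> 0) at_top"
      by (rule filterlim_compose[OF tendsto_power_div_exp_0])
         (rule filterlim_tendsto_pos_mult_at_top[OF tendsto_const c filterlim_ident])
    then have "((\<lambda>y. 1 / ?c ^ j * ((?c * y) ^ j / exp (?c * y))) \<longlongrightarrow> 1 / ?c ^ j * 0) at_top"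
      by (intro tendsto_intros)
    moreover have "1 / ?c ^ j * ((?c * y) ^ j / exp (?c * y)) = y ^ j * exp ((Im s - \<mu>) * y)" for y
    proof -
      have "exp ((Im s - \<mu>) * y) = inverse (exp (?c * y))"
        by (simp add: exp_minus[symmetric] algebra_simps)
      then show ?thesis using c by (simp add: power_mult_distrib divide_inverse)
    qed
    ultimately show ?thesis by simp
  qed
  then show ?thesis
  proof (rule Lim_null_comparison[rotated])
    show "\<forall>\<^sub>F y in at_top. norm (exp (- \<i> * s * of_real y) * exp_dd w j y) \<le> y ^ j * exp ((Im s - \<mu>) * y)"
      using eventually_ge_at_top[of 0]
    proof eventually_elim
      fix y :: real assume y: "0 \<le> y"
      have "norm (exp_dd w j y) \<le> y ^ j * exp (- \<mu> * y)"
        using y \<mu> by (intro exp_dd_bound) auto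
      then have "exp (Im s * y) * norm (exp_dd w j y) \<le> exp (Im s * y) * (y ^ j * exp (- \<mu> * y))"
        by (rule mult_left_mono) simp
      also have "\<dots> = y ^ j * exp ((Im s - \<mu>) * y)"
        by (simp add: algebra_simps flip: exp_add)
      finally show "norm (exp (- \<i> * s * of_real y) * exp_dd w j y) \<le> y ^ j * exp ((Im s - \<mu>) * y)"
        using y by (simp add: norm_mult)
    qed
  qed
qed

text \<open>
  Integrating \<open>(e^(-\<i> s y) h\<^sub>j(y))'\<close> over \<open>{x..}\<close> turns the differential equation of \<open>h\<^sub>j = exp_dd w j\<close>
  into a linear relation between two neighbouring tails and the boundary value. The relation is
  triangular, with diagonal entries \<open>\<i> (s - w j)\<close>.
\<close>

lemma exp_dd_tail_rec:
  assumes "\<And>m. m \<le> j \<Longrightarrow> Im s < Im (w m)"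
  shows "exp (- \<i> * s * of_real x) * exp_dd w j x =
    \<i> * (s - w j) * exp_dd_tail w s j x - (if j = 0 then 0 else exp_dd_tail w s (j - 1) x)"
proof -
  let ?e = "\<lambda>y. exp (- \<i> * s * of_real y)"
  let ?p = "\<lambda>y. if j = 0 then 0 else ?e y * exp_dd w (j - 1) y"
  have D: "((\<lambda>y. ?e y * exp_dd w j y) has_vector_derivative
      - \<i> * (s - w j) * (?e y * exp_dd w j y) + ?p y) (at y)" for y
  proof -
    have "(exp_dd w j has_vector_derivative \<i> * w j * exp_dd w j y + (if j = 0 then 0 else exp_dd w (j - 1) y)) (at y)"
      using exp_dd_ode_0[of w y UNIV] exp_dd_ode[of w "j - 1" y UNIV] by (cases j) (auto simp del: exp_dd.simps)
    from has_vector_derivative_mult[OF has_vector_derivative_exp_i[of "- s" y UNIV] this]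
    show ?thesis by (cases "j = 0") (simp_all add: algebra_simps del: exp_dd.simps)
  qed
  have I1: "set_integrable lborel {x..} (\<lambda>y. - \<i> * (s - w j) * (?e y * exp_dd w j y))"
    by (intro set_integrable_mult_right set_integrable_exp_dd assms)
  have I2: "set_integrable lborel {x..} ?p"
    using set_integrable_exp_dd[of "j - 1" s w x] assms by (cases "j = 0") (auto simp: set_integrable_def simp del: exp_dd.simps)
  have cont: "continuous_on UNIV (\<lambda>y. - \<i> * (s - w j) * (?e y * exp_dd w j y) + ?p y)"
    by (cases "j = 0") (auto intro!: continuous_intros continuous_exp_dd simp del: exp_dd.simps)
  note [measurable] = borel_measurable_continuous_onI[OF cont]
  have E: "{x<..} = einterval (ereal x) \<infinity>" by (auto simp: einterval_def)
  have "(LBINT y=ereal x..\<infinity>. - \<i> * (s - w j) * (?e y * exp_dd w j y) + ?p y) = 0 - ?e x * exp_dd w j x"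
  proof (rule interval_integral_FTC_integrable)
    show "((\<lambda>y. ?e y * exp_dd w j y) has_vector_derivative
      - \<i> * (s - w j) * (?e y * exp_dd w j y) + ?p y) (at y)" for y by (rule D)
    show "isCont (\<lambda>y. - \<i> * (s - w j) * (?e y * exp_dd w j y) + ?p y) y" for y
      using cont by (simp add: continuous_on_eq_continuous_at)
    show "set_integrable lborel (einterval (ereal x) \<infinity>) (\<lambda>y. - \<i> * (s - w j) * (?e y * exp_dd w j y) + ?p y)"
      unfolding E[symmetric]
      by (rule set_integrable_subset[OF set_integral_add(1)[OF I1 I2]]) auto
    have "continuous_on UNIV (\<lambda>y. ?e y * exp_dd w j y)"
      by (intro continuous_intros continuous_exp_dd)
    then have "((\<lambda>y. ?e y * exp_dd w j y) \<longlongrightarrow> ?e x * exp_dd w j x) (at x)"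
      by (simp add: continuous_on_eq_continuous_at isCont_def)
    then have "((\<lambda>y. ?e y * exp_dd w j y) \<longlongrightarrow> ?e x * exp_dd w j x) (at_right x)"
      by (rule tendsto_within_subset) simp
    then show "(((\<lambda>y. ?e y * exp_dd w j y) \<circ> real_of_ereal) \<longlongrightarrow> ?e x * exp_dd w j x) (at_right (ereal x))"
      by (simp add: ereal_tendsto_simps)
    show "(((\<lambda>y. ?e y * exp_dd w j y) \<circ> real_of_ereal) \<longlongrightarrow> 0) (at_left \<infinity>)"
      unfolding ereal_tendsto_simps by (rule exp_dd_tendsto_0[OF assms])
  qed simp
  also have "(LBINT y=ereal x..\<infinity>. - \<i> * (s - w j) * (?e y * exp_dd w j y) + ?p y) =
      (LINT y:{x..}|lborel. - \<i> * (s - w j) * (?e y * exp_dd w j y) + ?p y)"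
    unfolding interval_lebesgue_integral_def E[symmetric]
  proof (simp only: ereal_less_eq order.refl if_True ereal_infty_less_eq, rule set_integral_cong_set)
    let ?f = "\<lambda>y. - \<i> * (s - w j) * (?e y * exp_dd w j y) + ?p y"
    show "set_borel_measurable lborel {x<..} ?f" "set_borel_measurable lborel {x..} ?f"
      unfolding set_borel_measurable_def by measurable
    show "AE y in lborel. (y \<in> {x..}) = (y \<in> {x<..})"
      using AE_lborel_singleton[of x] by eventually_elim auto
  qed
  also have "\<dots> = - \<i> * (s - w j) * exp_dd_tail w s j x + (LINT y:{x..}|lborel. ?p y)"
    using set_integral_add(2)[OF I1 I2] unfolding exp_dd_tail_def by (simp only: set_integral_mult_right)
  also have "(LINT y:{x..}|lborel. ?p y) = (if j = 0 then 0 else exp_dd_tail w s (j - 1) x)"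
    by (simp add: exp_dd_tail_def)
  finally show ?thesis by (simp add: algebra_simps del: exp_dd.simps)
qed

text \<open>
  At \<open>x = 0\<close> only \<open>h\<^sub>0\<close> has a nonzero boundary value, so the recursion above collapses to a product.
\<close>

lemma exp_dd_laplace:
  assumes "\<And>m. m \<le> j \<Longrightarrow> Im s < Im (w m)"
  shows "exp_dd_tail w s j 0 = (\<Prod>m\<le>j. 1 / (\<i> * (s - w m)))"
  using assms
proof (induction j)
  case 0
  then have "s \<noteq> w 0" by force
  with exp_dd_tail_rec[of 0 s w 0] 0 show ?case by (simp add: field_simps)
next
  case (Suc j)
  from Suc.prems[of "Suc j"] have "s \<noteq> w (Suc j)" by auto
  with exp_dd_tail_rec[of "Suc j" s w 0] Suc show ?case
    by (simp add: field_simps exp_dd_at_0 del: exp_dd.simps)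
qed

section \<open>Fourier inversion\<close>

lemma fourier_gaussian:
  assumes "0 < \<delta>"
  shows "(\<integral>t. exp (- (\<delta> * t)\<^sup>2 / 2) *\<^sub>R exp (\<i> * of_real (t * v)) \<partial>lborel) =
    complex_of_real (2 * pi / \<delta> * std_normal_density (v / \<delta>))"
proof -
  have 1: "(\<integral>t. exp (- t\<^sup>2 / 2) *\<^sub>R exp (\<i> * of_real (t * v)) \<partial>lborel) =
    complex_of_real (2 * pi * std_normal_density v)" for v
  proof -
    have "(\<integral>t. std_normal_density t *\<^sub>R exp (\<i> * of_real (t * v)) \<partial>lborel) = char std_normal_distribution v"
      unfolding char_def by (subst integral_density) (auto simp: mult.commute)
    also have "\<dots> = complex_of_real (exp (- v\<^sup>2 / 2))"
      by (simp add: char_std_normal_distribution)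
    finally have *: "(\<integral>t. sqrt (2 * pi) *\<^sub>R (std_normal_density t *\<^sub>R exp (\<i> * of_real (t * v))) \<partial>lborel) =
       sqrt (2 * pi) *\<^sub>R complex_of_real (exp (- v\<^sup>2 / 2))"
      by (simp del: scaleR_scaleR)
    have "sqrt (2 * pi) * exp (- v\<^sup>2 / 2) = 2 * pi * std_normal_density v"
      by (simp add: std_normal_density_def field_simps flip: power2_eq_square)
    with * show ?thesis
      by (simp add: std_normal_density_def scaleR_conv_of_real flip: of_real_mult)
  qed
  have "(\<integral>t. exp (- (\<delta> * t)\<^sup>2 / 2) *\<^sub>R exp (\<i> * of_real (t * v)) \<partial>lborel) =
     \<bar>1 / \<delta>\<bar> *\<^sub>R (\<integral>t. exp (- (\<delta> * (0 + 1 / \<delta> * t))\<^sup>2 / 2) *\<^sub>R exp (\<i> * of_real ((0 + 1 / \<delta> * t) * v)) \<partial>lborel)"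
    by (rule lborel_integral_real_affine) (use assms in simp)
  also have "(\<integral>t. exp (- (\<delta> * (0 + 1 / \<delta> * t))\<^sup>2 / 2) *\<^sub>R exp (\<i> * of_real ((0 + 1 / \<delta> * t) * v)) \<partial>lborel) =
      (\<integral>t. exp (- t\<^sup>2 / 2) *\<^sub>R exp (\<i> * of_real (t * (v / \<delta>))) \<partial>lborel)"
    using assms by (intro Bochner_Integration.integral_cong) auto
  also note 1
  finally show ?thesis using assms by (simp add: scaleR_conv_of_real)
qed

lemma integrable_gaussian:
  assumes "0 < \<delta>"
  shows "integrable lborel (\<lambda>t::real. exp (- (\<delta> * t)\<^sup>2 / 2))"
proof -
  have "integrable lborel (\<lambda>t::real. sqrt (2 * pi) * (std_normal_density t))"
    using integrable_std_normal_moment[of 0] by simp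
  then have "integrable lborel (\<lambda>t::real. exp (- t\<^sup>2 / 2))"
    by (simp add: std_normal_density_def)
  then have "integrable lborel (\<lambda>t::real. exp (- (0 + \<delta> * t)\<^sup>2 / 2))"
    using assms by (subst lborel_integrable_real_affine_iff[where f="\<lambda>t. exp (- t\<^sup>2 / 2)"]) auto
  then show ?thesis by simp
qed

text \<open>
  Insert the Gaussian factor \<open>e^(-(\<delta> t)\<^sup>2 / 2)\<close>. Then Fubini applies and the regularised integral
  becomes the average of \<open>g (u + \<delta> \<eta>)\<close> over a standard normal variable \<open>\<eta>\<close>; both expressions
  converge by dominated convergence as \<open>\<delta>\<close> tends to 0.
\<close>

lemma fourier_inversion:
  fixes g :: "real \<Rightarrow> complex"
  assumes cont: "continuous_on UNIV g" and bdd: "\<And>x. norm (g x) \<le> B"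
    and g: "integrable lborel g"
  defines "h \<equiv> \<lambda>t. \<integral>y. exp (- \<i> * of_real (t * y)) * g y \<partial>lborel"
  assumes h: "integrable lborel h"
  shows "(\<integral>t. exp (\<i> * of_real (t * u)) * h t \<partial>lborel) = 2 * pi * g u"
proof -
  note [measurable] = borel_measurable_integrable[OF g] borel_measurable_integrable[OF h]
  have [measurable]: "g \<in> borel_measurable borel" by (rule borel_measurable_continuous_onI[OF cont])
  define \<delta> where "\<delta> n = 1 / (real n + 1)" for n
  have \<delta>: "0 < \<delta> n" for n by (simp add: \<delta>_def)
  have \<delta>0: "\<delta> \<longlonglongrightarrow> 0"
    unfolding \<delta>_def using LIMSEQ_inverse_real_of_nat by (simp add: inverse_eq_divide add.commute)
  define a where "a n = (\<integral>t. exp (- (\<delta> n * t)\<^sup>2 / 2) *\<^sub>R (exp (\<i> * of_real (t * u)) * h t) \<partial>lborel)" for n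
  have "a \<longlonglongrightarrow> (\<integral>t. exp (\<i> * of_real (t * u)) * h t \<partial>lborel)"
    unfolding a_def
  proof (rule integral_dominated_convergence)
    show "integrable lborel (\<lambda>t. norm (h t))" using h by simp
    show "AE t in lborel. (\<lambda>n. exp (- (\<delta> n * t)\<^sup>2 / 2) *\<^sub>R (exp (\<i> * of_real (t * u)) * h t)) \<longlonglongrightarrow> exp (\<i> * of_real (t * u)) * h t"
    proof (intro AE_I2)
      fix t
      have "(\<lambda>n. exp (- (\<delta> n * t)\<^sup>2 / 2) *\<^sub>R (exp (\<i> * of_real (t * u)) * h t)) \<longlonglongrightarrow> exp (- (0 * t)\<^sup>2 / 2) *\<^sub>R (exp (\<i> * of_real (t * u)) * h t)"
        by (intro tendsto_intros \<delta>0) auto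
      then show "(\<lambda>n. exp (- (\<delta> n * t)\<^sup>2 / 2) *\<^sub>R (exp (\<i> * of_real (t * u)) * h t)) \<longlonglongrightarrow> exp (\<i> * of_real (t * u)) * h t"
        by simp
    qed
    show "AE t in lborel. norm (exp (- (\<delta> n * t)\<^sup>2 / 2) *\<^sub>R (exp (\<i> * of_real (t * u)) * h t)) \<le> norm (h t)" for n
      by (intro AE_I2) (auto simp: norm_mult intro!: mult_left_le_one_le)
  qed measurable
  moreover have "a = (\<lambda>n. \<integral>\<eta>. (2 * pi * std_normal_density \<eta>) *\<^sub>R g (u + \<delta> n * \<eta>) \<partial>lborel)"
  proof (rule ext)
    fix n
    let ?F = "\<lambda>t y. exp (- (\<delta> n * t)\<^sup>2 / 2) *\<^sub>R (exp (\<i> * of_real (t * (u - y))) * g y)"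
    have F: "integrable (lborel \<Otimes>\<^sub>M lborel) (case_prod ?F)"
    proof (rule lborel_pair.Fubini_integrable)
      show "case_prod ?F \<in> borel_measurable (lborel \<Otimes>\<^sub>M lborel)" by measurable
      have "integrable lborel (\<lambda>t. exp (- (\<delta> n * t)\<^sup>2 / 2) * (\<integral>y. norm (g y) \<partial>lborel))"
        by (intro integrable_mult_left integrable_gaussian \<delta>)
      then show "integrable lborel (\<lambda>t. \<integral>y. norm (case_prod ?F (t, y)) \<partial>lborel)"
        by (simp add: norm_mult)
      show "AE t in lborel. integrable lborel (\<lambda>y. case_prod ?F (t, y))"
      proof (intro AE_I2)
        fix t
        have "integrable lborel (\<lambda>y. exp (\<i> * of_real (t * (u - y))) * g y)"
          by (rule Bochner_Integration.integrable_bound[OF g]) (auto simp: norm_mult)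
        then show "integrable lborel (\<lambda>y. case_prod ?F (t, y))" by simp
      qed
    qed
    have "a n = (\<integral>t. \<integral>y. ?F t y \<partial>lborel \<partial>lborel)"
      unfolding a_def
    proof (rule Bochner_Integration.integral_cong[OF refl])
      fix t
      have "exp (\<i> * of_real (t * u)) * h t = (\<integral>y. exp (\<i> * of_real (t * u)) * (exp (- \<i> * of_real (t * y)) * g y) \<partial>lborel)"
        unfolding h_def by simp
      also have "\<dots> = (\<integral>y. exp (\<i> * of_real (t * (u - y))) * g y \<partial>lborel)"
        by (intro Bochner_Integration.integral_cong) (auto simp: algebra_simps exp_diff exp_minus field_simps)
      finally show "exp (- (\<delta> n * t)\<^sup>2 / 2) *\<^sub>R (exp (\<i> * of_real (t * u)) * h t) = (\<integral>y. ?F t y \<partial>lborel)"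
        by simp
    qed
    also have "\<dots> = (\<integral>y. \<integral>t. ?F t y \<partial>lborel \<partial>lborel)"
      by (rule lborel_pair.Fubini_integral[OF F, symmetric])
    also have "\<dots> = (\<integral>y. complex_of_real (2 * pi / \<delta> n * std_normal_density ((u - y) / \<delta> n)) * g y \<partial>lborel)"
      unfolding fourier_gaussian[OF \<delta>, symmetric]
      by (intro Bochner_Integration.integral_cong[OF refl]) (simp flip: integral_mult_left_zero)
    also have "\<dots> = \<bar>\<delta> n\<bar> *\<^sub>R (\<integral>\<eta>. complex_of_real (2 * pi / \<delta> n * std_normal_density ((u - (u + \<delta> n * \<eta>)) / \<delta> n)) * g (u + \<delta> n * \<eta>) \<partial>lborel)"
      by (rule lborel_integral_real_affine) (use \<delta>[of n] in simp)
    also have "\<dots> = (\<integral>\<eta>. \<delta> n *\<^sub>R (complex_of_real (2 * pi / \<delta> n * std_normal_density ((u - (u + \<delta> n * \<eta>)) / \<delta> n)) * g (u + \<delta> n * \<eta>)) \<partial>lborel)"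
      using \<delta>[of n] by simp
    also have "\<dots> = (\<integral>\<eta>. (2 * pi * std_normal_density \<eta>) *\<^sub>R g (u + \<delta> n * \<eta>) \<partial>lborel)"
    proof (rule Bochner_Integration.integral_cong[OF refl])
      fix \<eta>
      show "\<delta> n *\<^sub>R (complex_of_real (2 * pi / \<delta> n * std_normal_density ((u - (u + \<delta> n * \<eta>)) / \<delta> n)) * g (u + \<delta> n * \<eta>)) =
         (2 * pi * std_normal_density \<eta>) *\<^sub>R g (u + \<delta> n * \<eta>)"
        using \<delta>[of n] by (simp add: std_normal_density_def scaleR_conv_of_real)
    qed
    finally show "a n = (\<integral>\<eta>. (2 * pi * std_normal_density \<eta>) *\<^sub>R g (u + \<delta> n * \<eta>) \<partial>lborel)" .
  qed
  moreover have "(\<lambda>n. \<integral>\<eta>. (2 * pi * std_normal_density \<eta>) *\<^sub>R g (u + \<delta> n * \<eta>) \<partial>lborel) \<longlonglongrightarrow>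
      (\<integral>\<eta>. (2 * pi * std_normal_density \<eta>) *\<^sub>R g u \<partial>lborel)"
  proof (rule integral_dominated_convergence)
    show "integrable lborel (\<lambda>\<eta>. 2 * pi * std_normal_density \<eta> * B)"
      using integrable_std_normal_moment[of 0] by simp
    show "AE \<eta> in lborel. (\<lambda>n. (2 * pi * std_normal_density \<eta>) *\<^sub>R g (u + \<delta> n * \<eta>)) \<longlonglongrightarrow> (2 * pi * std_normal_density \<eta>) *\<^sub>R g u"
    proof (intro AE_I2 tendsto_intros)
      fix \<eta>
      have "(\<lambda>n. u + \<delta> n * \<eta>) \<longlonglongrightarrow> u + 0 * \<eta>" by (intro tendsto_intros \<delta>0)
      moreover have "isCont g (u + 0 * \<eta>)" using cont by (simp add: continuous_on_eq_continuous_at)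
      ultimately show "(\<lambda>n. g (u + \<delta> n * \<eta>)) \<longlonglongrightarrow> g u"
        using isCont_tendsto_compose[of "u + 0 * \<eta>" g] by simp
    qed
    show "AE \<eta> in lborel. norm ((2 * pi * std_normal_density \<eta>) *\<^sub>R g (u + \<delta> n * \<eta>)) \<le> 2 * pi * std_normal_density \<eta> * B" for n
      by (intro AE_I2) (auto intro!: mult_left_mono bdd)
  qed measurable
  ultimately have "(\<integral>t. exp (\<i> * of_real (t * u)) * h t \<partial>lborel) = (\<integral>\<eta>. (2 * pi * std_normal_density \<eta>) *\<^sub>R g u \<partial>lborel)"
    using LIMSEQ_unique by metis
  also have "\<dots> = 2 * pi * g u"
    by (simp add: scaleR_conv_of_real integral_normal_density)
  finally show ?thesis .
qed

section \<open>Integrals over horizontal lines\<close>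

lemma integrable_inverse_square_line:
  assumes "Im z \<noteq> 0"
  shows "integrable lborel (\<lambda>t. 1 / (cmod (of_real t - z))\<^sup>2)"
proof -
  have "integrable lborel (\<lambda>t::real. inverse (1 + t\<^sup>2))"
    using integrable_inverse_1_plus_square by (simp add: set_integrable_def einterval_def)
  then have "integrable lborel (\<lambda>t::real. inverse (1 + (- Re z / \<bar>Im z\<bar> + 1 / \<bar>Im z\<bar> * t)\<^sup>2))"
    using assms by (intro lborel_integrable_real_affine) auto
  then have "integrable lborel (\<lambda>t::real. (1 / (Im z)\<^sup>2) * inverse (1 + (- Re z / \<bar>Im z\<bar> + 1 / \<bar>Im z\<bar> * t)\<^sup>2))"
    by (rule integrable_mult_right)
  moreover have "(1 / (Im z)\<^sup>2) * inverse (1 + (- Re z / \<bar>Im z\<bar> + 1 / \<bar>Im z\<bar> * t)\<^sup>2) = 1 / (cmod (of_real t - z))\<^sup>2" for t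
  proof -
    have "- Re z / \<bar>Im z\<bar> + 1 / \<bar>Im z\<bar> * t = (t - Re z) / \<bar>Im z\<bar>"
      using assms by (simp add: field_simps)
    then have "1 + (- Re z / \<bar>Im z\<bar> + 1 / \<bar>Im z\<bar> * t)\<^sup>2 = ((t - Re z)\<^sup>2 + (Im z)\<^sup>2) / (Im z)\<^sup>2"
      using assms by (simp add: power_divide field_simps)
    then show ?thesis
      using assms by (simp add: cmod_power2)
  qed
  ultimately show ?thesis by simp
qed

text \<open>
  Two factors already give quadratic decay on the line, and each further factor is bounded because
  the line stays away from the pole.
\<close>

lemma integrable_prod_inverse_line:
  assumes "\<And>m. m \<le> Suc j \<Longrightarrow> - \<epsilon> < Im (w m)"
  shows "integrable lborel (\<lambda>t. \<Prod>m\<le>Suc j. 1 / (of_real t - \<i> * of_real \<epsilon> - w m))"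
  using assms
proof (induction j)
  case 0
  let ?a = "\<lambda>m t. cmod (of_real t - (w m + \<i> * of_real \<epsilon>))"
  have I: "integrable lborel (\<lambda>t. 1 / (?a m t)\<^sup>2)" if "m \<le> 1" for m
    by (rule integrable_inverse_square_line) (use that 0[of m] in simp)
  have "integrable lborel (\<lambda>t. 1 / (?a 0 t)\<^sup>2 + 1 / (?a 1 t)\<^sup>2)"
    by (intro Bochner_Integration.integrable_add I) auto
  then show ?case
  proof (rule Bochner_Integration.integrable_bound)
    show "AE t in lborel. norm (\<Prod>m\<le>Suc 0. 1 / (of_real t - \<i> * of_real \<epsilon> - w m)) \<le> norm (1 / (?a 0 t)\<^sup>2 + 1 / (?a 1 t)\<^sup>2)"
    proof (intro AE_I2)
      fix t
      have *: "x * y \<le> x\<^sup>2 + y\<^sup>2" if "0 \<le> x" "0 \<le> y" for x y :: real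
        using sum_squares_bound[of x y] mult_nonneg_nonneg[OF that] by linarith
      have "of_real t - \<i> * of_real \<epsilon> - w m = of_real t - (w m + \<i> * of_real \<epsilon>)" for m
        by simp
      then have "norm (\<Prod>m\<le>Suc 0. 1 / (of_real t - \<i> * of_real \<epsilon> - w m)) = (1 / ?a 0 t) * (1 / ?a 1 t)"
        by (simp only: prod.atMost_Suc atMost_0 prod.insert finite.emptyI empty_iff not_False_eq_True
            prod.empty mult_1_right norm_mult norm_divide norm_one One_nat_def)
      also have "\<dots> \<le> (1 / ?a 0 t)\<^sup>2 + (1 / ?a 1 t)\<^sup>2"
        by (rule *) simp_all
      also have "\<dots> = norm (1 / (?a 0 t)\<^sup>2 + 1 / (?a 1 t)\<^sup>2)"
        by (simp only: power_one_over real_norm_def, rule abs_of_nonneg[symmetric], simp)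
      finally show "norm (\<Prod>m\<le>Suc 0. 1 / (of_real t - \<i> * of_real \<epsilon> - w m)) \<le> norm (1 / (?a 0 t)\<^sup>2 + 1 / (?a 1 t)\<^sup>2)" .
    qed
  qed measurable
next
  case (Suc j)
  let ?d = "Im (w (Suc (Suc j))) + \<epsilon>"
  have d: "0 < ?d" using Suc.prems[of "Suc (Suc j)"] by simp
  have "integrable lborel (\<lambda>t. (1 / ?d) *\<^sub>R (\<Prod>m\<le>Suc j. 1 / (of_real t - \<i> * of_real \<epsilon> - w m)))"
    using Suc by simp
  then show ?case
  proof (rule Bochner_Integration.integrable_bound)
    show "AE t in lborel. norm (\<Prod>m\<le>Suc (Suc j). 1 / (of_real t - \<i> * of_real \<epsilon> - w m)) \<le>
       norm ((1 / ?d) *\<^sub>R (\<Prod>m\<le>Suc j. 1 / (of_real t - \<i> * of_real \<epsilon> - w m)))"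
    proof (intro AE_I2)
      fix t
      have "?d \<le> cmod (of_real t - \<i> * of_real \<epsilon> - w (Suc (Suc j)))"
        using abs_Im_le_cmod[of "of_real t - \<i> * of_real \<epsilon> - w (Suc (Suc j))"] by simp
      then have "1 / cmod (of_real t - \<i> * of_real \<epsilon> - w (Suc (Suc j))) \<le> 1 / ?d"
        using d by (intro divide_left_mono mult_pos_pos) auto
      then have "cmod (\<Prod>m\<le>Suc j. 1 / (of_real t - \<i> * of_real \<epsilon> - w m)) * (1 / cmod (of_real t - \<i> * of_real \<epsilon> - w (Suc (Suc j))))
        \<le> cmod (\<Prod>m\<le>Suc j. 1 / (of_real t - \<i> * of_real \<epsilon> - w m)) * (1 / ?d)"
        by (rule mult_left_mono) simp
      then show "norm (\<Prod>m\<le>Suc (Suc j). 1 / (of_real t - \<i> * of_real \<epsilon> - w m)) \<le>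
       norm ((1 / ?d) *\<^sub>R (\<Prod>m\<le>Suc j. 1 / (of_real t - \<i> * of_real \<epsilon> - w m)))"
        using d unfolding prod.atMost_Suc[of _ "Suc j"] norm_mult norm_scaleR norm_divide by simp
    qed
  qed measurable
qed

text \<open>
  The product of simple fractions is, up to a power of \<open>\<i>\<close>, the Laplace transform of
  \<open>h = exp_dd w (Suc j)\<close> on the line \<open>Im \<gamma> = - \<epsilon>\<close>, that is, the Fourier transform of \<open>e^(-\<epsilon> y) h(y)\<close>
  cut off at \<open>y < 0\<close>. With at least two factors \<open>h(0) = 0\<close>, so the function that is cut off is
  continuous and Fourier inversion recovers it everywhere. This takes the place of closing the
  contour and summing residues, and it needs no distinction between simple and multiple poles.
\<close>

lemma line_integral_exp_dd:
  assumes w: "\<And>m. m \<le> Suc j \<Longrightarrow> - \<epsilon> < Im (w m)"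
  defines "\<gamma> \<equiv> \<lambda>t. complex_of_real t - \<i> * of_real \<epsilon>"
  shows "integrable lborel (\<lambda>t. exp (\<i> * \<gamma> t * of_real u) * (\<Prod>m\<le>Suc j. 1 / (\<gamma> t - w m)))"
    and "(\<integral>t. exp (\<i> * \<gamma> t * of_real u) * (\<Prod>m\<le>Suc j. 1 / (\<gamma> t - w m)) \<partial>lborel) =
      2 * pi * \<i> ^ (j + 2) * (if 0 \<le> u then exp_dd w (Suc j) u else 0)"
proof -
  have exp_split: "exp (\<i> * \<gamma> t * of_real u) = exp (of_real (\<epsilon> * u)) * exp (\<i> * of_real (t * u))" for t u
    by (simp add: \<gamma>_def algebra_simps flip: exp_add)
  have I: "integrable lborel (\<lambda>t. \<Prod>m\<le>Suc j. 1 / (\<gamma> t - w m))"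
    unfolding \<gamma>_def by (rule integrable_prod_inverse_line[OF w])
  then have "integrable lborel (\<lambda>t. exp (of_real (\<epsilon> * u)) *\<^sub>R (\<Prod>m\<le>Suc j. 1 / (\<gamma> t - w m)))"
    by simp
  then show "integrable lborel (\<lambda>t. exp (\<i> * \<gamma> t * of_real u) * (\<Prod>m\<le>Suc j. 1 / (\<gamma> t - w m)))"
    by (rule Bochner_Integration.integrable_bound) (auto simp: exp_split norm_mult \<gamma>_def simp del: prod.atMost_Suc)
  define g where "g y = (if 0 \<le> y then exp (- of_real (\<epsilon> * y)) * exp_dd w (Suc j) y else 0)" for y :: real
  have s: "Im (\<gamma> t) < Im (w m)" if "m \<le> Suc j" for m t
    using w[OF that] by (simp add: \<gamma>_def)
  have g_norm: "g y = indicator {0..} y *\<^sub>R (exp (- \<i> * (- \<i> * of_real \<epsilon>) * of_real y) * exp_dd w (Suc j) y)" for y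
    by (simp add: g_def)
  have "integrable lborel g"
    using set_integrable_exp_dd_atLeast_0[of "Suc j" "- \<i> * of_real \<epsilon>" w] w
    unfolding g_norm[abs_def] set_integrable_def by simp
  moreover have hat: "(\<integral>y. exp (- \<i> * of_real (t * y)) * g y \<partial>lborel) = (1 / \<i> ^ (j + 2)) * (\<Prod>m\<le>Suc j. 1 / (\<gamma> t - w m))" for t
  proof -
    have E: "exp (- \<i> * of_real (t * y)) * exp (- of_real (\<epsilon> * y)) = exp (- \<i> * \<gamma> t * of_real y)" for y
      unfolding exp_add[symmetric] by (rule arg_cong[where f=exp]) (simp add: \<gamma>_def algebra_simps)
    have "(\<integral>y. exp (- \<i> * of_real (t * y)) * g y \<partial>lborel) = exp_dd_tail w (\<gamma> t) (Suc j) 0"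
      unfolding exp_dd_tail_def set_lebesgue_integral_def
    proof (rule Bochner_Integration.integral_cong[OF refl])
      fix y
      show "exp (- \<i> * of_real (t * y)) * g y =
          indicat_real {0..} y *\<^sub>R (exp (- \<i> * \<gamma> t * of_real y) * exp_dd w (Suc j) y)"
        unfolding E[of y, symmetric] by (simp add: g_def del: exp_dd.simps split: split_indicator)
    qed
    also have "\<dots> = (\<Prod>m\<le>Suc j. 1 / (\<i> * (\<gamma> t - w m)))"
      by (rule exp_dd_laplace) (rule s)
    also have "\<dots> = (1 / \<i> ^ (j + 2)) * (\<Prod>m\<le>Suc j. 1 / (\<gamma> t - w m))"
    proof -
      have "(\<Prod>m\<le>Suc j. 1 / (\<i> * (\<gamma> t - w m))) = (\<Prod>m\<le>Suc j. (1 / \<i>) * (1 / (\<gamma> t - w m)))"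
        by (simp only: times_divide_times_eq mult_1_left)
      also have "\<dots> = (1 / \<i>) ^ (j + 2) * (\<Prod>m\<le>Suc j. 1 / (\<gamma> t - w m))"
        unfolding prod.distrib prod_constant by simp
      finally show ?thesis by (simp only: power_one_over)
    qed
    finally show ?thesis .
  qed
  moreover have "continuous_on UNIV g"
  proof -
    have "continuous_on ({0..} \<union> {..0}) g"
      unfolding g_def
      by (intro continuous_on_If continuous_intros continuous_on_subset[OF continuous_exp_dd])
         (auto simp: exp_dd_at_0 simp del: exp_dd.simps)
    moreover have "{0..} \<union> {..0} = (UNIV :: real set)" by auto
    ultimately show ?thesis by simp
  qed
  moreover have "\<exists>B. \<forall>y. norm (g y) \<le> B"
  proof -
    let ?f = "\<lambda>y. exp (- \<i> * (- \<i> * of_real \<epsilon>) * of_real y) * exp_dd w (Suc j) y"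
    have "(?f \<longlongrightarrow> 0) at_top"
      by (rule exp_dd_tendsto_0) (use w in simp)
    then have "\<forall>\<^sub>F y in at_top. norm (?f y) < 1"
      by (auto dest!: tendstoD[where e=1] simp: dist_norm)
    then obtain R where R: "\<And>y. R \<le> y \<Longrightarrow> norm (?f y) < 1"
      by (auto simp: eventually_at_top_linorder)
    have "compact (?f ` {0..\<bar>R\<bar>})"
      by (intro compact_continuous_image continuous_intros continuous_on_subset[OF continuous_exp_dd]) auto
    then obtain B where B: "\<And>y. y \<in> {0..\<bar>R\<bar>} \<Longrightarrow> norm (?f y) \<le> B"
      by (meson bounded_iff compact_imp_bounded imageI)
    have "norm (g y) \<le> max 1 B" for y
    proof (cases "0 \<le> y \<and> y \<le> \<bar>R\<bar>")
      case True
      then show ?thesis using B[of y] by (simp add: g_norm)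
    next
      case False
      show ?thesis
      proof (cases "0 \<le> y")
        case True
        with False have "R \<le> y" by linarith
        from R[OF this] have "norm (g y) < 1"
          using True by (simp add: g_norm del: exp_dd.simps)
        then show ?thesis by simp
      qed (simp add: g_def le_max_iff_disj)
    qed
    then show ?thesis by blast
  qed
  then obtain B where "\<And>y. norm (g y) \<le> B" by blast
  ultimately have e: "(\<integral>t. exp (\<i> * of_real (t * u)) * ((1 / \<i> ^ (j + 2)) * (\<Prod>m\<le>Suc j. 1 / (\<gamma> t - w m))) \<partial>lborel) = 2 * pi * g u"
    using fourier_inversion[of g B u] I unfolding hat by (simp del: prod.atMost_Suc)
  have m: "(\<integral>t. exp (\<i> * of_real (t * u)) * ((1 / \<i> ^ (j + 2)) * (\<Prod>m\<le>Suc j. 1 / (\<gamma> t - w m))) \<partial>lborel) =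
      (1 / \<i> ^ (j + 2)) * (\<integral>t. exp (\<i> * of_real (t * u)) * (\<Prod>m\<le>Suc j. 1 / (\<gamma> t - w m)) \<partial>lborel)"
    unfolding mult.left_commute[of _ "1 / \<i> ^ (j + 2)"] by (rule integral_mult_right_zero)
  have div: "a = c * b" if "(1 / c) * a = b" "c \<noteq> 0" for a b c :: complex
    using that by auto
  have X: "(\<integral>t. exp (\<i> * of_real (t * u)) * (\<Prod>m\<le>Suc j. 1 / (\<gamma> t - w m)) \<partial>lborel) = \<i> ^ (j + 2) * (2 * pi * g u)"
    by (rule div[OF trans[OF m[symmetric] e]]) simp
  have "(\<integral>t. exp (\<i> * \<gamma> t * of_real u) * (\<Prod>m\<le>Suc j. 1 / (\<gamma> t - w m)) \<partial>lborel) =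
      exp (of_real (\<epsilon> * u)) * (\<i> ^ (j + 2) * (2 * pi * g u))"
    unfolding exp_split X[symmetric] mult.assoc[of "exp (of_real (\<epsilon> * u))"] by (rule integral_mult_right_zero)
  also have "\<dots> = 2 * pi * \<i> ^ (j + 2) * (if 0 \<le> u then exp_dd w (Suc j) u else 0)"
    by (simp add: g_def exp_minus field_simps del: exp_dd.simps)
  finally show "(\<integral>t. exp (\<i> * \<gamma> t * of_real u) * (\<Prod>m\<le>Suc j. 1 / (\<gamma> t - w m)) \<partial>lborel) =
      2 * pi * \<i> ^ (j + 2) * (if 0 \<le> u then exp_dd w (Suc j) u else 0)" .
qed

section \<open>Determinants and their integrals\<close>

definition detf :: "nat \<Rightarrow> (nat \<Rightarrow> nat \<Rightarrow> complex) \<Rightarrow> complex" where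
  "detf n F = Determinant.det (Matrix.mat n n (\<lambda>(i, j). F i j))"

lemma detf_expand:
  "detf n F = (\<Sum>p | p permutes {0..<n}. signof p * (\<Prod>i<n. F i (p i)))"
proof -
  have "(\<Prod>i=0..<n. Matrix.mat n n (\<lambda>(i, j). F i j) $$ (i, p i)) = (\<Prod>i<n. F i (p i))"
    if "p permutes {0..<n}" for p
    unfolding atLeast0LessThan[symmetric]
    by (intro prod.cong) (use that permutes_in_image in \<open>fastforce+\<close>)
  then show ?thesis
    unfolding detf_def by (subst Determinant.det_def'[of _ n]) (auto intro!: sum.cong)
qed

lemma detf_cong:
  "(\<And>i j. i < n \<Longrightarrow> j < n \<Longrightarrow> F i j = G i j) \<Longrightarrow> detf n F = detf n G"
  unfolding detf_def by (intro arg_cong[of _ _ Determinant.det] Matrix.eq_matI) auto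

lemma detf_transpose: "detf n (\<lambda>i j. F j i) = detf n F"
proof -
  have "Matrix.mat n n (\<lambda>(i, j). F j i) = transpose_mat (Matrix.mat n n (\<lambda>(i, j). F i j))"
    by (rule Matrix.eq_matI) auto
  then show ?thesis
    unfolding detf_def by (simp only: Determinant.det_transpose[OF Matrix.mat_carrier])
qed

lemma detf_mult: "detf n F * detf n G = detf n (\<lambda>i j. \<Sum>k<n. F i k * G k j)"
proof -
  let ?A = "Matrix.mat n n (\<lambda>(i, j). F i j)" and ?B = "Matrix.mat n n (\<lambda>(i, j). G i j)"
  have "?A * ?B = Matrix.mat n n (\<lambda>(i, j). \<Sum>k<n. F i k * G k j)"
    by (rule Matrix.eq_matI) (auto simp: scalar_prod_def atLeast0LessThan)
  then show ?thesis
    unfolding detf_def by (subst Determinant.det_mult[symmetric, of _ n]) auto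
qed

lemma prod_list_diag_mat: "prod_list (diag_mat (Matrix.mat n n (\<lambda>(i, j). F i j))) = (\<Prod>i<n. F i i)"
proof -
  have "prod_list (diag_mat (Matrix.mat n n (\<lambda>(i, j). F i j))) = prod_list (map (\<lambda>i. F i i) [0..<n])"
    unfolding diag_mat_def by (intro arg_cong[of _ _ prod_list] map_cong) auto
  then show ?thesis
    by (simp add: prod.distinct_set_conv_list[symmetric] atLeast0LessThan)
qed

lemma detf_lower_triangular:
  assumes "\<And>i j. i < j \<Longrightarrow> j < n \<Longrightarrow> F i j = 0"
  shows "detf n F = (\<Prod>i<n. F i i)"
  unfolding detf_def using assms
  by (subst det_lower_triangular[of n]) (auto simp: prod_list_diag_mat)

lemma detf_upper_triangular:
  assumes "\<And>i j. j < i \<Longrightarrow> i < n \<Longrightarrow> F i j = 0"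
  shows "detf n F = (\<Prod>i<n. F i i)"
  unfolding detf_def using assms
  by (subst det_upper_triangular[of _ n]) (auto simp: prod_list_diag_mat)

lemma detf_scale:
  "detf n (\<lambda>i j. c i * F i j * d j) = (\<Prod>i<n. c i) * detf n F * (\<Prod>j<n. d j)"
proof -
  have "(\<Prod>i<n. c i * F i (p i) * d (p i)) = (\<Prod>i<n. c i) * (\<Prod>i<n. F i (p i)) * (\<Prod>j<n. d j)"
    if "p permutes {0..<n}" for p
    using prod.permute[OF that, of d] by (simp add: prod.distrib atLeast0LessThan o_def)
  then show ?thesis
    unfolding detf_expand sum_distrib_left sum_distrib_right
    by (intro sum.cong) (auto simp: algebra_simps)
qed

lemma detf_zero_row:
  assumes "i < n" and "\<And>j. j < n \<Longrightarrow> F i j = 0"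
  shows "detf n F = 0"
proof -
  have "F i (p i) = 0" if "p permutes {0..<n}" for p
    using assms permutes_in_image[OF that, of i] by auto
  then show ?thesis
    unfolding detf_expand using assms(1)
    by (intro sum.neutral) (auto intro: prod_zero)
qed

lemma detf_permute_rows:
  assumes "p permutes {0..<n}"
  shows "detf n (\<lambda>i j. F (p i) j) = signof p * detf n F"
proof -
  have "p i < n" if "i < n" for i using permutes_in_image[OF assms, of i] that by simp
  then show ?thesis
    unfolding detf_def
    by (subst det_permute_rows[OF _ assms, symmetric])
       (auto intro!: arg_cong[of _ _ Determinant.det] Matrix.eq_matI)
qed

lemma detf_unit_last_row:
  assumes "F n 0 = 1" and "\<And>j. 0 < j \<Longrightarrow> j \<le> n \<Longrightarrow> F n j = 0"
  shows "detf (Suc n) F = (- 1) ^ n * detf n (\<lambda>i j. F i (Suc j))"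
proof -
  let ?A = "Matrix.mat (Suc n) (Suc n) (\<lambda>(i, j). F i j)"
  have "detf (Suc n) F = (\<Sum>j<Suc n. ?A $$ (n, j) * cofactor ?A n j)"
    unfolding detf_def by (rule laplace_expansion_row) auto
  also have "\<dots> = (\<Sum>j<Suc n. if j = 0 then cofactor ?A n 0 else 0)"
    using assms by (intro sum.cong) auto
  also have "\<dots> = cofactor ?A n 0"
    by (simp add: sum.delta)
  also have "\<dots> = (- 1) ^ n * detf n (\<lambda>i j. F i (Suc j))"
  proof -
    have "mat_delete ?A n 0 = Matrix.mat n n (\<lambda>(i, j). F i (Suc j))"
      by (rule Matrix.eq_matI) (auto simp: mat_delete_def)
    then show ?thesis by (simp add: cofactor_def detf_def)
  qed
  finally show ?thesis .
qed

definition vandermonde :: "nat \<Rightarrow> (nat \<Rightarrow> complex) \<Rightarrow> complex" where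
  "vandermonde n \<gamma> = (\<Prod>k<n. \<Prod>m<k. \<gamma> k - \<gamma> m)"

text \<open>
  Replacing one family of monic polynomials of degrees \<open>0, 1, \<dots>, n - 1\<close> by another multiplies the
  matrix by a unitriangular one. For the Newton polynomials at the points themselves the matrix is
  triangular, which gives the value.
\<close>

lemma detf_poly_monic:
  assumes P: "\<And>j. j < n \<Longrightarrow> degree (P j) = j \<and> lead_coeff (P j) = 1"
  shows "detf n (\<lambda>k j. poly (P j) (\<gamma> k)) = vandermonde n \<gamma>"
proof -
  have V: "detf n (\<lambda>k j. poly (P j) (\<gamma> k)) = detf n (\<lambda>k i. \<gamma> k ^ i)"
    if P: "\<And>j. j < n \<Longrightarrow> degree (P j) = j \<and> lead_coeff (P j) = 1" for P
  proof -
    have "poly (P j) x = (\<Sum>i<n. x ^ i * coeff (P j) i)" if "j < n" for j x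
      unfolding poly_altdef using P[OF that] that
      by (intro sum.mono_neutral_cong_left) (auto simp: coeff_eq_0)
    then have "detf n (\<lambda>k j. poly (P j) (\<gamma> k)) = detf n (\<lambda>k j. \<Sum>i<n. \<gamma> k ^ i * coeff (P j) i)"
      by (intro detf_cong) auto
    also have "\<dots> = detf n (\<lambda>k i. \<gamma> k ^ i) * detf n (\<lambda>i j. coeff (P j) i)"
      by (rule detf_mult[symmetric])
    also have "detf n (\<lambda>i j. coeff (P j) i) = (\<Prod>i<n. coeff (P i) i)"
      using P by (intro detf_upper_triangular) (auto intro!: coeff_eq_0)
    also have "\<dots> = 1"
      using P by (intro prod.neutral) (metis lessThan_iff)
    finally show ?thesis by simp
  qed
  let ?N = "\<lambda>j. \<Prod>m<j. [:- \<gamma> m, 1:]"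
  have "degree (?N j) = j" "lead_coeff (?N j) = 1" for j
    by (simp add: degree_prod_eq_sum_degree, simp only: lead_coeff_prod, simp)
  then have "detf n (\<lambda>k i. \<gamma> k ^ i) = detf n (\<lambda>k j. poly (?N j) (\<gamma> k))"
    by (intro V[symmetric]) blast
  also have "\<dots> = (\<Prod>k<n. poly (?N k) (\<gamma> k))"
    by (intro detf_lower_triangular) (auto simp: poly_prod)
  also have "\<dots> = vandermonde n \<gamma>"
    by (simp add: vandermonde_def poly_prod)
  finally show ?thesis using V[OF P] by simp
qed

lemma prod_pairs_eq_vandermonde_square:
  "(\<Prod>s\<in>{1..n}. \<Prod>p\<in>{1..n} - {s}. \<gamma> s - \<gamma> p) =
    (\<Prod>k<n. (- 1) ^ k) * (vandermonde n (\<lambda>k. \<gamma> (Suc k)))\<^sup>2"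
proof (induction n)
  case 0
  then show ?case by (simp add: vandermonde_def)
next
  case (Suc n)
  have shift: "(\<Prod>s\<in>{1..n}. f s) = (\<Prod>s<n. f (Suc s))" for f :: "nat \<Rightarrow> complex"
    by (rule prod.reindex_bij_witness[of _ Suc "\<lambda>s. s - 1"]) auto
  have 1: "{1..Suc n} - {s} = insert (Suc n) ({1..n} - {s})" if "s \<in> {1..n}" for s
    using that by auto
  have 2: "{1..Suc n} - {Suc n} = {1..n}" by auto
  have "(\<Prod>s\<in>{1..Suc n}. \<Prod>p\<in>{1..Suc n} - {s}. \<gamma> s - \<gamma> p) =
     (\<Prod>p\<in>{1..n}. \<gamma> (Suc n) - \<gamma> p) * (\<Prod>s\<in>{1..n}. (\<gamma> s - \<gamma> (Suc n)) * (\<Prod>p\<in>{1..n} - {s}. \<gamma> s - \<gamma> p))"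
  proof -
    have "(\<Prod>s\<in>{1..Suc n}. \<Prod>p\<in>{1..Suc n} - {s}. \<gamma> s - \<gamma> p) =
      (\<Prod>p\<in>{1..Suc n} - {Suc n}. \<gamma> (Suc n) - \<gamma> p) * (\<Prod>s\<in>{1..n}. \<Prod>p\<in>{1..Suc n} - {s}. \<gamma> s - \<gamma> p)"
      by (simp add: atLeastAtMostSuc_conv)
    also have "(\<Prod>s\<in>{1..n}. \<Prod>p\<in>{1..Suc n} - {s}. \<gamma> s - \<gamma> p) =
       (\<Prod>s\<in>{1..n}. (\<gamma> s - \<gamma> (Suc n)) * (\<Prod>p\<in>{1..n} - {s}. \<gamma> s - \<gamma> p))"
      by (intro prod.cong refl) (subst 1, auto)
    finally show ?thesis unfolding 2 .
  qed
  also have "\<dots> = (\<Prod>p\<in>{1..n}. \<gamma> (Suc n) - \<gamma> p) * (\<Prod>s\<in>{1..n}. (- 1) * (\<gamma> (Suc n) - \<gamma> s)) *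
      (\<Prod>s\<in>{1..n}. \<Prod>p\<in>{1..n} - {s}. \<gamma> s - \<gamma> p)"
    by (simp add: prod.distrib)
  also have "\<dots> = (\<Prod>p<n. \<gamma> (Suc n) - \<gamma> (Suc p))\<^sup>2 * (- 1) ^ n *
     ((\<Prod>k<n. (- 1) ^ k) * (vandermonde n (\<lambda>k. \<gamma> (Suc k)))\<^sup>2)"
    unfolding Suc.IH prod.distrib shift by (simp add: power2_eq_square algebra_simps)
  also have "\<dots> = (\<Prod>k<Suc n. (- 1) ^ k) * (vandermonde (Suc n) (\<lambda>k. \<gamma> (Suc k)))\<^sup>2"
    by (simp add: vandermonde_def power_mult_distrib algebra_simps)
  finally show ?case .
qed

lemma detf_integral:
  fixes F :: "nat \<Rightarrow> nat \<Rightarrow> real \<Rightarrow> complex"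
  assumes e: "bij_betw e {..<n} I"
    and F: "\<And>a b. a < n \<Longrightarrow> b < n \<Longrightarrow> integrable lborel (F a b)"
  shows "has_bochner_integral (Pi\<^sub>M I (\<lambda>_. lborel)) (\<lambda>t. detf n (\<lambda>a b. F a b (t (e a))))
    (detf n (\<lambda>a b. \<integral>u. F a b u \<partial>lborel))"
  unfolding detf_expand
proof (intro has_bochner_integral_sum has_bochner_integral_mult_right)
  fix p assume "p \<in> {p. p permutes {0..<n}}"
  then have p: "p permutes {0..<n}" by simp
  interpret product_sigma_finite "\<lambda>_. lborel :: real measure" by standard
  define e' where "e' = the_inv_into {..<n} e"
  have e': "e' (e a) = a" if "a < n" for a
    using e that unfolding e'_def bij_betw_def by (auto intro: the_inv_into_f_f)
  have fin: "finite I" using e bij_betw_finite by blast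
  have re: "(\<Prod>i\<in>I. \<phi> i) = (\<Prod>a<n. \<phi> (e a))" for \<phi> :: "_ \<Rightarrow> complex"
    by (rule prod.reindex_bij_betw[OF e, symmetric])
  have pn: "p a < n" if "a < n" for a using permutes_in_image[OF p, of a] that by simp
  have I: "integrable lborel (F (e' i) (p (e' i)))" if i: "i \<in> I" for i
  proof -
    obtain a where "a < n" "i = e a" using e i unfolding bij_betw_def by auto
    then show ?thesis using F pn by (simp add: e')
  qed
  have "has_bochner_integral (Pi\<^sub>M I (\<lambda>_. lborel)) (\<lambda>t. \<Prod>i\<in>I. F (e' i) (p (e' i)) (t i))
      (\<Prod>i\<in>I. \<integral>u. F (e' i) (p (e' i)) u \<partial>lborel)"
    unfolding has_bochner_integral_iff
    by (intro conjI product_integrable_prod product_integral_prod fin I)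
  then show "has_bochner_integral (Pi\<^sub>M I (\<lambda>_. lborel)) (\<lambda>t. \<Prod>a<n. F a (p a) (t (e a)))
      (\<Prod>a<n. \<integral>u. F a (p a) u \<partial>lborel)"
    unfolding re by (simp add: e')
qed

text \<open>
  Andreief's identity, in a form in which the functions may also depend on the index \<open>a\<close> of the
  variable as long as the integrals \<open>K b j\<close> do not. This is what happens when each variable runs
  over a horizontal line of its own height: the integrands differ from line to line, their
  integrals do not.
\<close>

lemma andreief:
  fixes f g :: "nat \<Rightarrow> nat \<Rightarrow> real \<Rightarrow> complex"
  assumes e: "bij_betw e {..<n} I"
    and fg: "\<And>a b j. a < n \<Longrightarrow> b < n \<Longrightarrow> j < n \<Longrightarrow>
      has_bochner_integral lborel (\<lambda>u. f a b u * g a j u) (K b j)"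
  shows "has_bochner_integral (Pi\<^sub>M I (\<lambda>_. lborel))
    (\<lambda>t. detf n (\<lambda>a b. f a b (t (e a))) * detf n (\<lambda>a j. g a j (t (e a)))) (fact n * detf n K)"
proof -
  let ?S = "{p. p permutes {0..<n}}"
  \<comment> \<open>Expand only the first determinant; each of its products is absorbed into the rows of the second one.\<close>
  have A: "has_bochner_integral (Pi\<^sub>M I (\<lambda>_. lborel))
    (\<lambda>t. \<Sum>p\<in>?S. signof p * detf n (\<lambda>a j. f a (p a) (t (e a)) * g a j (t (e a))))
    (\<Sum>p\<in>?S. signof p * detf n (\<lambda>a j. K (p a) j))"
  proof (intro has_bochner_integral_sum has_bochner_integral_mult_right)
    fix p assume "p \<in> ?S"
    then have p: "p permutes {0..<n}" by simp
    have pn: "p a < n" if "a < n" for a using permutes_in_image[OF p, of a] that by simp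
    have I: "integrable lborel (\<lambda>u. f a (p a) u * g a j u)" if "a < n" "j < n" for a j
      using fg[OF that(1) pn[OF that(1)] that(2)] by (rule integrable.intros)
    have int: "has_bochner_integral (Pi\<^sub>M I (\<lambda>_. lborel))
       (\<lambda>t. detf n (\<lambda>a j. f a (p a) (t (e a)) * g a j (t (e a))))
       (detf n (\<lambda>a j. \<integral>u. f a (p a) u * g a j u \<partial>lborel))"
      by (rule detf_integral[OF e, of "\<lambda>a j u. f a (p a) u * g a j u"])
         (rule I)
    have eq: "detf n (\<lambda>a j. \<integral>u. f a (p a) u * g a j u \<partial>lborel) = detf n (\<lambda>a j. K (p a) j)"
      by (rule detf_cong, rule has_bochner_integral_integral_eq, rule fg) (auto intro: pn)
    show "has_bochner_integral (Pi\<^sub>M I (\<lambda>_. lborel))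
       (\<lambda>t. detf n (\<lambda>a j. f a (p a) (t (e a)) * g a j (t (e a)))) (detf n (\<lambda>a j. K (p a) j))"
      using int unfolding eq .
  qed
  have B: "(\<Sum>p\<in>?S. signof p * detf n (\<lambda>a j. K (p a) j)) = fact n * detf n K"
  proof -
    have "(\<Sum>p\<in>?S. signof p * detf n (\<lambda>a j. K (p a) j)) = (\<Sum>p\<in>?S. detf n K)"
    proof (rule sum.cong[OF refl])
      fix p assume "p \<in> ?S"
      then have p: "p permutes {0..<n}" ..
      have s: "signof p * signof p = (1 :: complex)"
        unfolding of_int_mult[symmetric] sign_idempotent by (rule of_int_1)
      show "signof p * detf n (\<lambda>a j. K (p a) j) = detf n K"
        unfolding detf_permute_rows[OF p, of K] mult.assoc[symmetric] s by (rule mult_1_left)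
    qed
    also have "\<dots> = of_nat (card ?S) * detf n K"
      by (rule sum_constant)
    also have "card ?S = fact n"
      by (rule card_permutations) simp_all
    finally show ?thesis unfolding of_nat_fact .
  qed
  have C: "(\<lambda>t. \<Sum>p\<in>?S. signof p * detf n (\<lambda>a j. f a (p a) (t (e a)) * g a j (t (e a)))) =
      (\<lambda>t. detf n (\<lambda>a b. f a b (t (e a))) * detf n (\<lambda>a j. g a j (t (e a))))"
  proof (rule ext)
    fix t
    show "(\<Sum>p\<in>?S. signof p * detf n (\<lambda>a j. f a (p a) (t (e a)) * g a j (t (e a)))) =
      detf n (\<lambda>a b. f a b (t (e a))) * detf n (\<lambda>a j. g a j (t (e a)))"
    unfolding detf_expand[of n "\<lambda>a b. f a b (t (e a))"] sum_distrib_right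
  proof (rule sum.cong[OF refl])
    fix p
    show "signof p * detf n (\<lambda>a j. f a (p a) (t (e a)) * g a j (t (e a))) =
        signof p * (\<Prod>a<n. f a (p a) (t (e a))) * detf n (\<lambda>a j. g a j (t (e a)))"
      using detf_scale[of n "\<lambda>a. f a (p a) (t (e a))" "\<lambda>a j. g a j (t (e a))" "\<lambda>_. 1"]
      by (simp only: mult_1_right prod.neutral_const mult.assoc)
  qed
  qed
  show ?thesis using A unfolding B C .
qed

section \<open>The closed form of the Whittaker function\<close>

text \<open>
  The triangular array of integration variables with a complex top row \<open>z\<close>. In the induction on the
  number of rows, the row that was integrated last becomes the top row of the smaller array.
\<close>

definition gt_array ::
  "nat \<Rightarrow> (nat \<Rightarrow> complex) \<Rightarrow> (nat \<Rightarrow> nat \<Rightarrow> real) \<Rightarrow> (nat \<times> nat \<Rightarrow> real) \<Rightarrow> nat \<Rightarrow> nat \<Rightarrow> complex" where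
  "gt_array n z eps t k j =
     (if j < 1 \<or> k < j then 0
      else if k = n + 1 then z j
      else of_real (t (k, j)) - \<i> * of_real (eps k j))"

definition heights_below :: "nat \<Rightarrow> (nat \<Rightarrow> complex) \<Rightarrow> (nat \<Rightarrow> nat \<Rightarrow> real) \<Rightarrow> bool" where
  "heights_below n z eps \<longleftrightarrow> (\<forall>k\<in>{1..n}. \<forall>j\<in>{1..k}. \<forall>m\<in>{1..k+1}.
     - eps k j < (if k = n then Im (z m) else - eps (k + 1) m))"

definition weyl_chamber :: "nat \<Rightarrow> (nat \<Rightarrow> real) set" where
  "weyl_chamber N = {x. \<forall>b. 1 \<le> b \<and> b < N \<longrightarrow> x (Suc b) \<le> x b}"

text \<open>
  For distinct parameters this is \<open>det (e^(\<i> z\<^sub>a x\<^sub>b))\<close> divided by a Vandermonde product and a power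
  of \<open>\<i>\<close>. Parameters and coordinates are numbered from 1, rows and columns from 0.
\<close>

definition exp_dd_det :: "nat \<Rightarrow> (nat \<Rightarrow> complex) \<Rightarrow> (nat \<Rightarrow> real) \<Rightarrow> complex" where
  "exp_dd_det N z x = detf N (\<lambda>b j. exp_dd (\<lambda>m. z (Suc m)) j (x (Suc b)))"

lemma vandermonde_mult_exp_dd_det:
  "(\<Prod>k<N. \<i> ^ k) * vandermonde N (\<lambda>a. z (Suc a)) * exp_dd_det N z x =
    detf N (\<lambda>a b. exp (\<i> * z (Suc a) * of_real (x (Suc b))))"
proof -
  let ?w = "\<lambda>m. z (Suc m)"
  let ?c = "\<lambda>a j. \<Prod>m<j. \<i> * (?w a - ?w m)"
  have "detf N (\<lambda>a b. exp (\<i> * ?w a * of_real (x (Suc b)))) =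
      detf N (\<lambda>a b. \<Sum>j<N. ?c a j * exp_dd ?w j (x (Suc b)))"
    by (intro detf_cong exp_eq_sum_exp_dd)
  also have "\<dots> = detf N ?c * detf N (\<lambda>j b. exp_dd ?w j (x (Suc b)))"
    by (rule detf_mult[symmetric])
  also have "detf N (\<lambda>j b. exp_dd ?w j (x (Suc b))) = exp_dd_det N z x"
    unfolding exp_dd_det_def by (rule detf_transpose)
  also have "detf N ?c = (\<Prod>a<N. ?c a a)"
    by (rule detf_lower_triangular) auto
  also have "\<dots> = (\<Prod>k<N. \<i> ^ k) * vandermonde N ?w"
    by (simp add: vandermonde_def prod.distrib)
  finally show ?thesis by simp
qed

text \<open>
  Translating all coordinates by the last one costs a triangular matrix, after which the last row is
  \<open>(1, 0, \<dots>, 0)\<close> because only \<open>exp_dd w 0\<close> is nonzero at 0.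
\<close>

lemma exp_dd_det_expand_last:
  "exp_dd_det (Suc n) z x = (\<Prod>j<Suc n. exp (\<i> * z (Suc j) * of_real (x (Suc n)))) * (- 1) ^ n *
     detf n (\<lambda>b j. exp_dd (\<lambda>m. z (Suc m)) (Suc j) (x (Suc b) - x (Suc n)))"
proof -
  let ?w = "\<lambda>m. z (Suc m)" and ?c = "x (Suc n)"
  let ?M = "\<lambda>k j. if k \<le> j then exp_dd (\<lambda>m. ?w (k + m)) (j - k) ?c else 0"
  have "exp_dd_det (Suc n) z x = detf (Suc n) (\<lambda>b j. \<Sum>k<Suc n. exp_dd ?w k (x (Suc b) - ?c) * ?M k j)"
    unfolding exp_dd_det_def
  proof (rule detf_cong)
    fix b j assume "j < Suc n"
    have "exp_dd ?w j (x (Suc b)) = exp_dd ?w j ((x (Suc b) - ?c) + ?c)" by simp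
    also have "\<dots> = (\<Sum>k\<le>j. exp_dd ?w k (x (Suc b) - ?c) * exp_dd (\<lambda>m. ?w (k + m)) (j - k) ?c)"
      by (rule exp_dd_add)
    also have "\<dots> = (\<Sum>k<Suc n. exp_dd ?w k (x (Suc b) - ?c) * ?M k j)"
      using \<open>j < Suc n\<close> by (intro sum.mono_neutral_cong_left) (auto simp del: exp_dd.simps)
    finally show "exp_dd ?w j (x (Suc b)) = (\<Sum>k<Suc n. exp_dd ?w k (x (Suc b) - ?c) * ?M k j)" .
  qed
  also have "\<dots> = detf (Suc n) (\<lambda>b k. exp_dd ?w k (x (Suc b) - ?c)) * detf (Suc n) ?M"
    by (rule detf_mult[symmetric])
  also have "detf (Suc n) ?M = (\<Prod>j<Suc n. ?M j j)"
    by (rule detf_upper_triangular) auto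
  also have "detf (Suc n) (\<lambda>b k. exp_dd ?w k (x (Suc b) - ?c)) =
      (- 1) ^ n * detf n (\<lambda>b j. exp_dd ?w (Suc j) (x (Suc b) - ?c))"
    by (rule detf_unit_last_row) (auto simp: exp_dd_at_0 simp del: exp_dd.simps)
  finally show ?thesis by (simp add: mult_ac del: exp_dd.simps(2) prod.lessThan_Suc)
qed

text \<open>
  Multiplying row \<open>k\<close> of the right-hand matrix by its common denominator leaves the values at \<open>\<gamma> k\<close> of monic
  polynomials of degrees \<open>n - 1, \<dots>, 0\<close>, so the determinant is the Vandermonde product up to the
  sign \<open>\<rho>\<close> of the reversal of the columns.
\<close>

lemma ex_vandermonde_over_products:
  "\<exists>\<rho>. \<forall>\<gamma> w. (\<forall>k<n. \<forall>m\<le>n. \<gamma> k \<noteq> w m) \<longrightarrow>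
     vandermonde n \<gamma> * (\<Prod>k<n. \<Prod>m\<le>n. 1 / (\<gamma> k - w m)) =
     \<rho> * detf n (\<lambda>k j. \<Prod>m\<le>Suc j. 1 / (\<gamma> k - w m))"
proof (intro exI allI impI)
  fix \<gamma> w :: "nat \<Rightarrow> complex"
  assume ne: "\<forall>k<n. \<forall>m\<le>n. \<gamma> k \<noteq> w m"
  let ?R = "\<lambda>i j. if i = n - Suc j then 1 else 0 :: complex"
  let ?r = "\<lambda>i. \<Prod>m\<in>{Suc (n - i)..n}. [:- w m, 1:]"
  have RR: "detf n ?R * detf n ?R = 1"
  proof -
    have "detf n ?R * detf n ?R = detf n (\<lambda>i j. \<Sum>k<n. ?R i k * ?R k j)"
      by (rule detf_mult)
    also have "\<dots> = detf n (\<lambda>i j. if i = j then 1 else 0)"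
    proof (rule detf_cong)
      fix i j assume ij: "i < n" "j < n"
      have "(\<Sum>k<n. ?R i k * ?R k j) = (\<Sum>k<n. if k = n - Suc j then ?R i (n - Suc j) else 0)"
        by (intro sum.cong) auto
      also have "\<dots> = ?R i (n - Suc j)" using ij by (simp add: sum.delta)
      also have "\<dots> = (if i = j then 1 else 0)" using ij by (auto simp: Suc_diff_Suc)
      finally show "(\<Sum>k<n. ?R i k * ?R k j) = (if i = j then 1 else 0)" .
    qed
    also have "\<dots> = 1" by (subst detf_lower_triangular) auto
    finally show ?thesis .
  qed
  have deg: "degree (?r i) = i \<and> lead_coeff (?r i) = 1" if "i < n" for i
  proof
    show "degree (?r i) = i"
      using that by (simp add: degree_prod_eq_sum_degree)
    show "lead_coeff (?r i) = 1"
      by (simp only: lead_coeff_prod) simp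
  qed
  have "detf n (\<lambda>k j. poly (?r j) (\<gamma> k)) = vandermonde n \<gamma>"
    by (rule detf_poly_monic) (rule deg)
  then have "vandermonde n \<gamma> * detf n ?R = detf n (\<lambda>k j. poly (?r j) (\<gamma> k)) * detf n ?R"
    by (simp only:)
  also have "\<dots> = detf n (\<lambda>k j. \<Sum>i<n. poly (?r i) (\<gamma> k) * ?R i j)"
    by (rule detf_mult)
  also have "\<dots> = detf n (\<lambda>k j. poly (?r (n - Suc j)) (\<gamma> k))"
  proof (rule detf_cong)
    fix k j assume j: "j < n"
    have "(\<Sum>i<n. poly (?r i) (\<gamma> k) * ?R i j) = (\<Sum>i<n. if i = n - Suc j then poly (?r i) (\<gamma> k) else 0)"
      by (intro sum.cong) auto
    also have "\<dots> = poly (?r (n - Suc j)) (\<gamma> k)"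
      using j by (simp add: sum.delta)
    finally show "(\<Sum>i<n. poly (?r i) (\<gamma> k) * ?R i j) = poly (?r (n - Suc j)) (\<gamma> k)" .
  qed
  finally have VR: "vandermonde n \<gamma> * detf n ?R = detf n (\<lambda>k j. poly (?r (n - Suc j)) (\<gamma> k))" .
  have V: "vandermonde n \<gamma> = detf n ?R * detf n (\<lambda>k j. poly (?r (n - Suc j)) (\<gamma> k))"
    unfolding VR[symmetric] mult.left_commute[of "detf n ?R"] RR by (rule mult_1_right[symmetric])
  have "vandermonde n \<gamma> * (\<Prod>k<n. \<Prod>m\<le>n. 1 / (\<gamma> k - w m)) =
     detf n ?R * detf n (\<lambda>k j. (\<Prod>m\<le>n. 1 / (\<gamma> k - w m)) * poly (?r (n - Suc j)) (\<gamma> k) * 1)"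
    unfolding V detf_scale by simp
  also have "detf n (\<lambda>k j. (\<Prod>m\<le>n. 1 / (\<gamma> k - w m)) * poly (?r (n - Suc j)) (\<gamma> k) * 1) =
     detf n (\<lambda>k j. \<Prod>m\<le>Suc j. 1 / (\<gamma> k - w m))"
  proof (rule detf_cong)
    fix k j assume kj: "k < n" "j < n"
    have S: "{..n} = {..Suc j} \<union> {Suc (Suc j)..n}" using kj by auto
    have "(\<Prod>m\<le>n. 1 / (\<gamma> k - w m)) = (\<Prod>m\<le>Suc j. 1 / (\<gamma> k - w m)) * (\<Prod>m\<in>{Suc (Suc j)..n}. 1 / (\<gamma> k - w m))"
      unfolding S by (rule prod.union_disjoint) auto
    moreover have "(\<Prod>m\<in>{Suc (Suc j)..n}. 1 / (\<gamma> k - w m)) * poly (?r (n - Suc j)) (\<gamma> k) = 1"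
    proof -
      have "Suc (n - (n - Suc j)) = Suc (Suc j)" using kj by simp
      then have "(\<Prod>m\<in>{Suc (Suc j)..n}. 1 / (\<gamma> k - w m)) * poly (?r (n - Suc j)) (\<gamma> k) =
         (\<Prod>m\<in>{Suc (Suc j)..n}. 1 / (\<gamma> k - w m) * (\<gamma> k - w m))"
        unfolding prod.distrib by (simp add: poly_prod)
      also have "\<dots> = 1"
        using ne kj by (intro prod.neutral) auto
      finally show ?thesis .
    qed
    ultimately show "(\<Prod>m\<le>n. 1 / (\<gamma> k - w m)) * poly (?r (n - Suc j)) (\<gamma> k) * 1 = (\<Prod>m\<le>Suc j. 1 / (\<gamma> k - w m))"
      by (simp add: mult.assoc)
  qed
  finally show "vandermonde n \<gamma> * (\<Prod>k<n. \<Prod>m\<le>n. 1 / (\<gamma> k - w m)) =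
     detf n ?R * detf n (\<lambda>k j. \<Prod>m\<le>Suc j. 1 / (\<gamma> k - w m))" .
qed

text \<open>
  The factors of the integrand that contain the variables \<open>\<gamma>\<close> of the last row below the top row \<open>z\<close>, apart
  from those which link \<open>\<gamma>\<close> to the rows further down; \<open>\<xi>\<close> is the last coordinate.
\<close>

definition row_factor :: "nat \<Rightarrow> (nat \<Rightarrow> complex) \<Rightarrow> (nat \<Rightarrow> complex) \<Rightarrow> real \<Rightarrow> complex" where
  "row_factor n z \<gamma> \<xi> =
     (\<Prod>s\<in>{1..n}. \<Prod>p\<in>{1..n} - {s}. \<gamma> s - \<gamma> p) / (fact n * (\<Prod>k=1..n. \<Prod>m=1..n+1. \<gamma> k - z m))
     * exp (\<i> * ((\<Sum>j=1..n+1. z j) - (\<Sum>j=1..n. \<gamma> j)) * of_real \<xi>)"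

text \<open>
  The recursion step. Of the two Vandermonde factors of the row, one turns \<open>exp_dd_det\<close> into the
  determinant of the exponentials \<open>e^(\<i> \<gamma>\<^sub>a x\<^sub>b)\<close> and the other turns the denominators into a
  determinant of simple fractions. Andreief's identity reduces the integral to the line integrals
  computed above. Each of them vanishes for \<open>x\<^sub>b < x\<^sub>n\<^sub>+\<^sub>1\<close>, which supplies the missing wall of
  the Weyl chamber. The constant is the same for all parameters.
\<close>

lemma row_integral:
  assumes n: "1 \<le> n"
  shows "\<exists>C. \<forall>z \<epsilon> x. (\<forall>j\<in>{1..n}. \<forall>m\<in>{1..n+1}. - \<epsilon> j < Im (z m)) \<longrightarrow>
    has_bochner_integral (Pi\<^sub>M ({n} \<times> {1..n}) (\<lambda>_. lborel))
      (\<lambda>r. row_factor n z (\<lambda>j. of_real (r (n, j)) - \<i> * of_real (\<epsilon> j)) (x (n + 1)) *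
         (if x \<in> weyl_chamber n then exp_dd_det n (\<lambda>j. of_real (r (n, j)) - \<i> * of_real (\<epsilon> j)) x else 0))
      (C * (if x \<in> weyl_chamber (n + 1) then exp_dd_det (n + 1) z x else 0))"
proof -
  obtain \<rho> where \<rho>: "\<And>\<gamma> w. (\<forall>k<n. \<forall>m\<le>n. \<gamma> k \<noteq> w m) \<Longrightarrow>
     vandermonde n \<gamma> * (\<Prod>k<n. \<Prod>m\<le>n. 1 / (\<gamma> k - w m)) =
     \<rho> * detf n (\<lambda>k j. \<Prod>m\<le>Suc j. 1 / (\<gamma> k - w m))"
    using ex_vandermonde_over_products[of n] by blast
  define \<sigma> :: complex where "\<sigma> = (\<Prod>k<n. (- 1) ^ k)"
  define \<iota> :: complex where "\<iota> = (\<Prod>k<n. \<i> ^ k)"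
  define \<kappa> :: complex where "\<kappa> = (\<Prod>j<n. 2 * pi * \<i> ^ (j + 2))"
  have \<iota>0: "\<iota> \<noteq> 0" by (simp add: \<iota>_def)
  have shift1: "(\<Prod>k=1..n. f k) = (\<Prod>k<n. f (Suc k))" for f :: "nat \<Rightarrow> complex"
    by (rule prod.reindex_bij_witness[of _ Suc "\<lambda>s. s - 1"]) auto
  have shift2: "(\<Prod>k=1..n+1. f k) = (\<Prod>k\<le>n. f (Suc k))" for f :: "nat \<Rightarrow> complex"
    by (rule prod.reindex_bij_witness[of _ Suc "\<lambda>s. s - 1"]) auto
  have shift3: "(\<Sum>k=1..n. f k) = (\<Sum>k<n. f (Suc k))" for f :: "nat \<Rightarrow> complex"
    by (rule sum.reindex_bij_witness[of _ Suc "\<lambda>s. s - 1"]) auto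
  have shift4: "(\<Sum>k=1..n+1. f k) = (\<Sum>k<Suc n. f (Suc k))" for f :: "nat \<Rightarrow> complex"
    by (rule sum.reindex_bij_witness[of _ Suc "\<lambda>s. s - 1"]) auto
  show ?thesis
  proof (intro exI allI impI)
    fix z :: "nat \<Rightarrow> complex" and \<epsilon> x :: "nat \<Rightarrow> real"
    assume below: "\<forall>j\<in>{1..n}. \<forall>m\<in>{1..n+1}. - \<epsilon> j < Im (z m)"
    define w where "w m = z (Suc m)" for m
    define X where "X b = x (Suc b)" for b
    define E where "E = (\<Prod>m<Suc n. exp (\<i> * w m * of_real (X n)))"
    define g :: "nat \<Rightarrow> real \<Rightarrow> complex" where "g a u = of_real u - \<i> * of_real (\<epsilon> (Suc a))" for a u
    define K where "K b j = 2 * pi * \<i> ^ (j + 2) * (if 0 \<le> X b - X n then exp_dd w (Suc j) (X b - X n) else 0)" for b j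
    have E0: "E \<noteq> 0" by (simp add: E_def)
    have below': "- \<epsilon> (Suc a) < Im (w m)" if "a < n" "m \<le> n" for a m
      using below that by (auto simp: w_def)
    have bij: "bij_betw (\<lambda>a. (n, Suc a)) {..<n} ({n} \<times> {1..n})"
      by (rule bij_betwI[of _ _ _ "\<lambda>q. snd q - 1"]) auto
    have A: "has_bochner_integral (Pi\<^sub>M ({n} \<times> {1..n}) (\<lambda>_. lborel))
       (\<lambda>r. detf n (\<lambda>a b. exp (\<i> * g a (r (n, Suc a)) * of_real (X b - X n))) *
            detf n (\<lambda>a j. \<Prod>m\<le>Suc j. 1 / (g a (r (n, Suc a)) - w m)))
       (fact n * detf n K)"
    proof (rule andreief[OF bij, of "\<lambda>a b u. exp (\<i> * g a u * of_real (X b - X n))" "\<lambda>a j u. \<Prod>m\<le>Suc j. 1 / (g a u - w m)" K])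
      fix a b j assume abj: "a < n" "b < n" "j < n"
      have "- \<epsilon> (Suc a) < Im (w m)" if "m \<le> Suc j" for m
        using below' abj that by simp
      from line_integral_exp_dd[where j = j and w = w and \<epsilon> = "\<epsilon> (Suc a)" and u = "X b - X n", OF this]
      show "has_bochner_integral lborel (\<lambda>u. exp (\<i> * g a u * of_real (X b - X n)) * (\<Prod>m\<le>Suc j. 1 / (g a u - w m))) (K b j)"
        unfolding has_bochner_integral_iff g_def K_def by blast
    qed
    have detK: "(if x \<in> weyl_chamber n then E * detf n K else 0) =
        \<kappa> * (- 1) ^ n * (if x \<in> weyl_chamber (n + 1) then exp_dd_det (n + 1) z x else 0)"
    proof (cases "x \<in> weyl_chamber (n + 1)")
      case True
      then have x: "x \<in> weyl_chamber n" by (auto simp: weyl_chamber_def)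
      have "x (Suc n) \<le> x (Suc b)" if "b \<le> n" for b
        using that
      proof (induction rule: inc_induct)
        case (step m)
        then show ?case using True by (force simp: weyl_chamber_def)
      qed simp
      then have "K b j = 1 * exp_dd w (Suc j) (X b - X n) * (2 * pi * \<i> ^ (j + 2))" if "b < n" for b j
        using that by (simp add: K_def X_def del: exp_dd.simps)
      then have "detf n K = detf n (\<lambda>b j. 1 * exp_dd w (Suc j) (X b - X n) * (2 * pi * \<i> ^ (j + 2)))"
        by (intro detf_cong)
      also have "\<dots> = detf n (\<lambda>b j. exp_dd w (Suc j) (X b - X n)) * \<kappa>"
        unfolding detf_scale \<kappa>_def by simp
      finally have e1: "detf n K = detf n (\<lambda>b j. exp_dd w (Suc j) (X b - X n)) * \<kappa>" .
      have e2: "exp_dd_det (n + 1) z x = E * (- 1) ^ n * detf n (\<lambda>b j. exp_dd w (Suc j) (X b - X n))"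
        using exp_dd_det_expand_last[of n z x] unfolding E_def w_def[abs_def] X_def by simp
      have "E * (D * \<kappa>) = \<kappa> * (- 1) ^ n * (E * (- 1) ^ n * D)" for D
        by (simp flip: power_add)
      then show ?thesis
        unfolding if_P[OF x] if_P[OF True] e1 e2 .
    next
      case False
      show ?thesis
      proof (cases "x \<in> weyl_chamber n")
        case True
        with False have "x (Suc n) > x n"
          by (auto simp: weyl_chamber_def less_Suc_eq)
        then have "detf n K = 0"
          using n by (intro detf_zero_row[of "n - 1"]) (auto simp: K_def X_def)
        with False show ?thesis by simp
      qed (use False in simp)
    qed
    have I: "row_factor n z (\<lambda>j. of_real (r (n, j)) - \<i> * of_real (\<epsilon> j)) (x (n + 1)) *
         (if x \<in> weyl_chamber n then exp_dd_det n (\<lambda>j. of_real (r (n, j)) - \<i> * of_real (\<epsilon> j)) x else 0) =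
       (if x \<in> weyl_chamber n then \<sigma> * \<rho> / (fact n * \<iota>) * E else 0) *
         (detf n (\<lambda>a b. exp (\<i> * g a (r (n, Suc a)) * of_real (X b - X n))) *
            detf n (\<lambda>a j. \<Prod>m\<le>Suc j. 1 / (g a (r (n, Suc a)) - w m)))" for r
    proof -
      define \<gamma> :: "nat \<Rightarrow> complex" where "\<gamma> j = of_real (r (n, j)) - \<i> * of_real (\<epsilon> j)" for j
      define h where "h a = g a (r (n, Suc a))" for a
      have h: "\<gamma> (Suc a) = h a" for a by (simp add: \<gamma>_def h_def g_def)
      define V where "V = vandermonde n h"
      define P where "P = (\<Prod>k<n. \<Prod>m\<le>n. 1 / (h k - w m))"
      have ne: "\<forall>k<n. \<forall>m\<le>n. h k \<noteq> w m"
      proof (intro allI impI)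
        fix k m assume "k < n" "m \<le> n"
        then have "Im (h k) < Im (w m)" using below' by (simp add: h_def g_def)
        then show "h k \<noteq> w m" by auto
      qed
      have 1: "(\<Prod>s\<in>{1..n}. \<Prod>p\<in>{1..n} - {s}. \<gamma> s - \<gamma> p) = \<sigma> * (V * V)"
        unfolding prod_pairs_eq_vandermonde_square h V_def \<sigma>_def power2_eq_square ..
      have 2: "1 / (\<Prod>k=1..n. \<Prod>m=1..n+1. \<gamma> k - z m) = P"
        unfolding shift1 shift2 h P_def w_def prod_dividef by simp
      have 3: "exp (\<i> * ((\<Sum>j=1..n+1. z j) - (\<Sum>j=1..n. \<gamma> j)) * of_real (x (n + 1))) =
          E * (\<Prod>a<n. exp (- \<i> * h a * of_real (X n)))"
        unfolding shift3 shift4 h E_def w_def[symmetric] exp_sum[symmetric, OF finite_lessThan] exp_add[symmetric]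
        by (simp add: X_def sum_distrib_left sum_distrib_right sum_negf algebra_simps)
      have 4: "V * exp_dd_det n \<gamma> x = detf n (\<lambda>a b. exp (\<i> * h a * of_real (X b))) / \<iota>"
        using vandermonde_mult_exp_dd_det[of n \<gamma> x] \<iota>0 unfolding h V_def \<iota>_def X_def by (simp add: field_simps)
      have 5: "V * P = \<rho> * detf n (\<lambda>k j. \<Prod>m\<le>Suc j. 1 / (h k - w m))"
        unfolding V_def P_def by (rule \<rho>[OF ne])
      have 6: "(\<Prod>a<n. exp (- \<i> * h a * of_real (X n))) * detf n (\<lambda>a b. exp (\<i> * h a * of_real (X b))) =
          detf n (\<lambda>a b. exp (\<i> * h a * of_real (X b - X n)))"
      proof -
        have "detf n (\<lambda>a b. exp (\<i> * h a * of_real (X b - X n))) =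
          detf n (\<lambda>a b. exp (- \<i> * h a * of_real (X n)) * exp (\<i> * h a * of_real (X b)) * 1)"
          by (intro detf_cong) (simp add: algebra_simps flip: exp_add)
        then show ?thesis unfolding detf_scale by simp
      qed
      have "\<sigma> * (V * V) / (fact n * Q) * (E * e) * D = \<sigma> / fact n * E * (V * (1 / Q)) * (e * (V * D))" for Q e D
        by simp
      from this[of "\<Prod>k=1..n. \<Prod>m=1..n+1. \<gamma> k - z m" "\<Prod>a<n. exp (- \<i> * h a * of_real (X n))" "exp_dd_det n \<gamma> x"]
      have "(\<Prod>s\<in>{1..n}. \<Prod>p\<in>{1..n} - {s}. \<gamma> s - \<gamma> p) / (fact n * (\<Prod>k=1..n. \<Prod>m=1..n+1. \<gamma> k - z m))
         * exp (\<i> * ((\<Sum>j=1..n+1. z j) - (\<Sum>j=1..n. \<gamma> j)) * of_real (x (n + 1))) * exp_dd_det n \<gamma> x =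
         \<sigma> * \<rho> / (fact n * \<iota>) * E *
         (detf n (\<lambda>a b. exp (\<i> * h a * of_real (X b - X n))) *
            detf n (\<lambda>a j. \<Prod>m\<le>Suc j. 1 / (h a - w m)))"
        unfolding 1 2 3 4 5 6[symmetric] by simp
      then show ?thesis
        unfolding row_factor_def \<gamma>_def[symmetric] h_def[symmetric] by simp
    qed
    have "has_bochner_integral (Pi\<^sub>M ({n} \<times> {1..n}) (\<lambda>_. lborel))
      (\<lambda>r. row_factor n z (\<lambda>j. of_real (r (n, j)) - \<i> * of_real (\<epsilon> j)) (x (n + 1)) *
         (if x \<in> weyl_chamber n then exp_dd_det n (\<lambda>j. of_real (r (n, j)) - \<i> * of_real (\<epsilon> j)) x else 0))
      ((if x \<in> weyl_chamber n then \<sigma> * \<rho> / (fact n * \<iota>) * E else 0) * (fact n * detf n K))"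
      unfolding I by (rule has_bochner_integral_mult_right[OF A])
    moreover have "(if x \<in> weyl_chamber n then \<sigma> * \<rho> / (fact n * \<iota>) * E else 0) * (fact n * detf n K) =
        \<sigma> * \<rho> / \<iota> * (if x \<in> weyl_chamber n then E * detf n K else 0)"
      by simp
    ultimately show "has_bochner_integral (Pi\<^sub>M ({n} \<times> {1..n}) (\<lambda>_. lborel))
      (\<lambda>r. row_factor n z (\<lambda>j. of_real (r (n, j)) - \<i> * of_real (\<epsilon> j)) (x (n + 1)) *
         (if x \<in> weyl_chamber n then exp_dd_det n (\<lambda>j. of_real (r (n, j)) - \<i> * of_real (\<epsilon> j)) x else 0))
      (\<sigma> * \<rho> / \<iota> * \<kappa> * (- 1) ^ n * (if x \<in> weyl_chamber (n + 1) then exp_dd_det (n + 1) z x else 0))"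
      unfolding detK by (simp only: mult.assoc)
  qed
qed

abbreviation gt_indices :: "nat \<Rightarrow> (nat \<times> nat) set" where
  "gt_indices n \<equiv> (SIGMA k:{1..n}. {1..k})"

lemma Psi0_integrand_cong:
  assumes "\<And>k j. k \<le> Suc n \<Longrightarrow> \<gamma> k j = \<gamma>' k j"
  shows "Psi0_integrand n x \<gamma> = Psi0_integrand n x \<gamma>'"
  unfolding Psi0_integrand_def using assms
  by (intro arg_cong2[of _ _ _ _ "(*)"] arg_cong2[of _ _ _ _ "(/)"] arg_cong[of _ _ exp] prod.cong sum.cong refl) auto

lemma Psi0_integrand_Suc:
  assumes "\<gamma> (Suc n) (Suc (Suc n)) = 0"
  shows "Psi0_integrand (Suc n) x \<gamma> =
    row_factor (Suc n) (\<gamma> (Suc (Suc n))) (\<gamma> (Suc n)) (x (Suc (Suc n))) * Psi0_integrand n x \<gamma>"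
proof -
  have "(\<Sum>j=1..Suc (Suc n). (\<gamma> (Suc (Suc n)) j - \<gamma> (Suc n) j) * of_real (x (Suc (Suc n)))) =
     ((\<Sum>j=1..Suc (Suc n). \<gamma> (Suc (Suc n)) j) - (\<Sum>j=1..Suc n. \<gamma> (Suc n) j)) * of_real (x (Suc (Suc n)))"
    using assms by (simp add: sum_subtractf flip: sum_distrib_right)
  then have S: "\<i> * (\<Sum>j=1..Suc (Suc n). (\<gamma> (Suc (Suc n)) j - \<gamma> (Suc (Suc n) - 1) j) * of_real (x (Suc (Suc n)))) =
     \<i> * ((\<Sum>j=1..Suc n+1. \<gamma> (Suc (Suc n)) j) - (\<Sum>j=1..Suc n. \<gamma> (Suc n) j)) * of_real (x (Suc (Suc n)))"
    by (simp only: diff_Suc_1 Suc_eq_plus1[symmetric] mult.assoc)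
  have prod_Suc: "(\<Prod>k=1..Suc n. f k) = f (Suc n) * (\<Prod>k=1..n. f k)" for f :: "nat \<Rightarrow> complex"
    by (simp add: mult.commute)
  have sum_Suc: "(\<Sum>k=1..Suc n+1. f k) = f (Suc (Suc n)) + (\<Sum>k=1..n+1. f k)" for f :: "nat \<Rightarrow> complex"
    by (simp add: add.commute)
  show ?thesis
    unfolding Psi0_integrand_def row_factor_def
    by (simp only: prod_Suc sum_Suc ring_distribs(1)[of \<i>] S exp_add) (simp only: Suc_eq_plus1 mult_ac)
qed

lemma gt_array_merge:
  assumes "k \<le> Suc n"
  shows "gt_array (Suc n) z eps (merge ({Suc n} \<times> {1..Suc n}) (gt_indices n) (r, t)) k j =
    gt_array n (\<lambda>j. of_real (r (Suc n, j)) - \<i> * of_real (eps (Suc n) j)) eps t k j"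
  using assms by (auto simp: gt_array_def merge_def)

lemma heights_below_Suc:
  assumes "heights_below (Suc n) z eps"
  shows "heights_below n (\<lambda>j. of_real (r (Suc n, j)) - \<i> * of_real (eps (Suc n) j)) eps"
    and "\<forall>j\<in>{1..Suc n}. \<forall>m\<in>{1..Suc n+1}. - eps (Suc n) j < Im (z m)"
proof -
  have h: "- eps k j < (if k = Suc n then Im (z m) else - eps (k + 1) m)"
    if "k \<in> {1..Suc n}" "j \<in> {1..k}" "m \<in> {1..k+1}" for k j m
    using assms that unfolding heights_below_def by blast
  show "heights_below n (\<lambda>j. of_real (r (Suc n, j)) - \<i> * of_real (eps (Suc n) j)) eps"
    unfolding heights_below_def
  proof (intro ballI)
    fix k j m assume "k \<in> {1..n}" "j \<in> {1..k}" "m \<in> {1..k+1}"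
    with h[of k j m] show "- eps k j < (if k = n
        then Im (of_real (r (Suc n, m)) - \<i> * of_real (eps (Suc n) m)) else - eps (k + 1) m)"
      by (auto split: if_splits)
  qed
  show "\<forall>j\<in>{1..Suc n}. \<forall>m\<in>{1..Suc n+1}. - eps (Suc n) j < Im (z m)"
    using h[of "Suc n"] by auto
qed

text \<open>
  Induction on the number of rows, by Fubini with the last row as the outer variable. The inner
  integral is known wherever it converges absolutely, hence for almost every value of the last row
  at which the row factor is nonzero; where the row factor vanishes there is nothing to compute.
\<close>

lemma integral_Psi0_integrand:
  "\<exists>c. \<forall>z eps x. heights_below n z eps \<longrightarrow>
     integrable (Pi\<^sub>M (gt_indices n) (\<lambda>_. lborel)) (\<lambda>t. Psi0_integrand n x (gt_array n z eps t)) \<longrightarrow>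
     (\<integral>t. Psi0_integrand n x (gt_array n z eps t) \<partial>Pi\<^sub>M (gt_indices n) (\<lambda>_. lborel)) =
       c * (if x \<in> weyl_chamber (n + 1) then exp_dd_det (n + 1) z x else 0)"
proof (induction n)
  case 0
  have "Psi0_integrand 0 x (gt_array 0 z eps t) = exp_dd_det (0 + 1) z x" for z eps x t
    by (simp add: Psi0_integrand_def gt_array_def exp_dd_det_def detf_expand mult.assoc)
  moreover have "x \<in> weyl_chamber (0 + 1)" for x by (simp add: weyl_chamber_def)
  moreover have "gt_indices 0 = {}" by auto
  ultimately show ?case
    by (intro exI[of _ 1]) (simp add: PiM_empty lebesgue_integral_count_space_finite)
next
  case (Suc n)
  obtain c where c: "\<And>z eps x. heights_below n z eps \<Longrightarrow>
     integrable (Pi\<^sub>M (gt_indices n) (\<lambda>_. lborel)) (\<lambda>t. Psi0_integrand n x (gt_array n z eps t)) \<Longrightarrow>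
     (\<integral>t. Psi0_integrand n x (gt_array n z eps t) \<partial>Pi\<^sub>M (gt_indices n) (\<lambda>_. lborel)) =
       c * (if x \<in> weyl_chamber (n + 1) then exp_dd_det (n + 1) z x else 0)"
    using Suc by blast
  let ?I = "{Suc n} \<times> {1..Suc n}" and ?J = "gt_indices n"
  let ?row = "\<lambda>\<epsilon> r j. complex_of_real (r (Suc n, j)) - \<i> * of_real (\<epsilon> j)"
  obtain C where C: "\<And>z \<epsilon> x. (\<forall>j\<in>{1..Suc n}. \<forall>m\<in>{1..Suc n+1}. - \<epsilon> j < Im (z m)) \<Longrightarrow>
    has_bochner_integral (Pi\<^sub>M ?I (\<lambda>_. lborel))
      (\<lambda>r. row_factor (Suc n) z (?row \<epsilon> r) (x (Suc n + 1)) *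
         (if x \<in> weyl_chamber (Suc n) then exp_dd_det (Suc n) (?row \<epsilon> r) x else 0))
      (C * (if x \<in> weyl_chamber (Suc n + 1) then exp_dd_det (Suc n + 1) z x else 0))"
  proof -
    have "1 \<le> Suc n" by simp
    from row_integral[OF this] show thesis using that by blast
  qed
  have IJ: "gt_indices (Suc n) = ?I \<union> ?J" "?I \<inter> ?J = {}" "finite ?I" "finite ?J"
    by (auto simp: le_Suc_eq)
  interpret P: product_sigma_finite "\<lambda>_. lborel :: real measure" by standard
  interpret PI: finite_product_sigma_finite "\<lambda>_. lborel :: real measure" ?I by standard (fact IJ)
  interpret PJ: finite_product_sigma_finite "\<lambda>_. lborel :: real measure" ?J by standard (fact IJ)
  interpret PP: pair_sigma_finite "Pi\<^sub>M ?I (\<lambda>_. lborel :: real measure)" "Pi\<^sub>M ?J (\<lambda>_. lborel :: real measure)" ..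
  show ?case
  proof (intro exI allI impI)
    fix z eps x
    assume hb: "heights_below (Suc n) z eps"
    let ?f = "\<lambda>t. Psi0_integrand (Suc n) x (gt_array (Suc n) z eps t)"
    let ?\<gamma> = "?row (eps (Suc n))"
    let ?R = "\<lambda>r. row_factor (Suc n) z (?\<gamma> r) (x (Suc n + 1))"
    let ?W = "\<lambda>r. if x \<in> weyl_chamber (Suc n) then exp_dd_det (Suc n) (?\<gamma> r) x else 0"
    let ?P = "\<lambda>r t. Psi0_integrand n x (gt_array n (?\<gamma> r) eps t)"
    assume "integrable (Pi\<^sub>M (gt_indices (Suc n)) (\<lambda>_. lborel)) ?f"
    then have int: "integrable (Pi\<^sub>M (?I \<union> ?J) (\<lambda>_. lborel)) ?f"
      unfolding IJ(1) .
    have split: "?f (merge ?I ?J (r, t)) = ?R r * ?P r t" for r t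
    proof -
      let ?g = "gt_array (Suc n) z eps (merge ?I ?J (r, t))"
      have "?f (merge ?I ?J (r, t)) = row_factor (Suc n) (?g (Suc (Suc n))) (?g (Suc n)) (x (Suc (Suc n))) * Psi0_integrand n x ?g"
        by (rule Psi0_integrand_Suc) (simp add: gt_array_def)
      also have "Psi0_integrand n x ?g = ?P r t"
        by (intro Psi0_integrand_cong gt_array_merge)
      also have "row_factor (Suc n) (?g (Suc (Suc n))) (?g (Suc n)) (x (Suc (Suc n))) = ?R r"
      proof -
        have "?g (Suc (Suc n)) j = z j" if "j \<in> {1..Suc (Suc n)}" for j
          using that by (simp add: gt_array_def)
        moreover have "?g (Suc n) j = ?\<gamma> r j" if "j \<in> {1..Suc n}" for j
          using that by (simp add: gt_array_def merge_def)
        ultimately show ?thesis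
          unfolding row_factor_def
          by (intro arg_cong2[of _ _ _ _ "(*)"] arg_cong2[of _ _ _ _ "(/)"] arg_cong2[of _ _ _ _ "(-)"]
              arg_cong[of _ _ exp] prod.cong sum.cong refl) auto
      qed
      finally show ?thesis .
    qed
    have int2: "integrable (Pi\<^sub>M ?I (\<lambda>_. lborel) \<Otimes>\<^sub>M Pi\<^sub>M ?J (\<lambda>_. lborel)) (\<lambda>q. ?f (merge ?I ?J q))"
      by (rule integrable_distr[OF measurable_merge]) (simp only: P.distr_merge[OF IJ(2-4)] int)
    have hb': "heights_below n (?\<gamma> r) eps" for r
      by (rule heights_below_Suc(1)[OF hb])
    have "has_bochner_integral (Pi\<^sub>M ?I (\<lambda>_. lborel)) (\<lambda>r. c * (?R r * ?W r))
      (c * (C * (if x \<in> weyl_chamber (Suc n + 1) then exp_dd_det (Suc n + 1) z x else 0)))"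
      by (intro has_bochner_integral_mult_right C heights_below_Suc(2)[OF hb])
    then have W: "integrable (Pi\<^sub>M ?I (\<lambda>_. lborel)) (\<lambda>r. c * (?R r * ?W r))"
      "(\<integral>r. c * (?R r * ?W r) \<partial>Pi\<^sub>M ?I (\<lambda>_. lborel)) =
        c * (C * (if x \<in> weyl_chamber (Suc n + 1) then exp_dd_det (Suc n + 1) z x else 0))"
      unfolding has_bochner_integral_iff by blast+
    have "(\<integral>t. ?f t \<partial>Pi\<^sub>M (gt_indices (Suc n)) (\<lambda>_. lborel)) =
       (\<integral>r. \<integral>t. ?f (merge ?I ?J (r, t)) \<partial>Pi\<^sub>M ?J (\<lambda>_. lborel) \<partial>Pi\<^sub>M ?I (\<lambda>_. lborel))"
      unfolding IJ(1) by (rule P.product_integral_fold[OF IJ(2-4) int])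
    also have "\<dots> = (\<integral>r. c * (?R r * ?W r) \<partial>Pi\<^sub>M ?I (\<lambda>_. lborel))"
    proof (rule integral_cong_AE)
      show "(\<lambda>r. \<integral>t. ?f (merge ?I ?J (r, t)) \<partial>Pi\<^sub>M ?J (\<lambda>_. lborel)) \<in> borel_measurable (Pi\<^sub>M ?I (\<lambda>_. lborel))"
        using PP.integrable_fst'[OF int2] by (rule borel_measurable_integrable)
      show "(\<lambda>r. c * (?R r * ?W r)) \<in> borel_measurable (Pi\<^sub>M ?I (\<lambda>_. lborel))"
        using W(1) by (rule borel_measurable_integrable)
      show "AE r in Pi\<^sub>M ?I (\<lambda>_. lborel). (\<integral>t. ?f (merge ?I ?J (r, t)) \<partial>Pi\<^sub>M ?J (\<lambda>_. lborel)) = c * (?R r * ?W r)"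
        using PP.AE_integrable_fst'[OF int2]
      proof eventually_elim
        case (elim r)
        show ?case
        proof (cases "?R r = 0")
          case True
          then show ?thesis unfolding split by simp
        next
          case False
          have "integrable (Pi\<^sub>M ?J (\<lambda>_. lborel)) (\<lambda>t. inverse (?R r) * (?R r * ?P r t))"
            using elim unfolding split by (rule integrable_mult_right)
          then have "integrable (Pi\<^sub>M ?J (\<lambda>_. lborel)) (?P r)"
            by (simp only: mult.assoc[symmetric] left_inverse[OF False] mult_1_left)
          from c[OF hb' this] show ?thesis unfolding split by simp
        qed
      qed
    qed
    also note W(2)
    finally show "(\<integral>t. ?f t \<partial>Pi\<^sub>M (gt_indices (Suc n)) (\<lambda>_. lborel)) =
      c * C * (if x \<in> weyl_chamber (Suc n + 1) then exp_dd_det (Suc n + 1) z x else 0)"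
      by (simp only: mult.assoc)
  qed
qed

lemma gam_eq_gt_array: "gam l lam eps t = gt_array l (\<lambda>j. of_real (lam j)) eps t"
  by (intro ext) (simp add: gam_def gt_array_def)

lemma admissible_imp_heights_below:
  assumes "admissible l lam eps"
  shows "heights_below l (\<lambda>j. of_real (lam j)) eps"
  unfolding heights_below_def
proof (intro ballI)
  fix k j m assume k: "k \<in> {1..l}" and j: "j \<in> {1..k}" and m: "m \<in> {1..k+1}"
  let ?g = "gam l lam eps (\<lambda>_. 0)"
  have "Im (?g k j) \<le> Max ((\<lambda>j. Im (?g k j)) ` {1..k})"
    using j by (intro Max_ge) auto
  also have "\<dots> < Min ((\<lambda>m. Im (?g (k+1) m)) ` {1..k+1})"
    using assms k unfolding admissible_def by blast
  also have "\<dots> \<le> Im (?g (k+1) m)"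
    using m by (intro Min_le) auto
  finally show "- eps k j < (if k = l then Im (of_real (lam m)) else - eps (k + 1) m)"
    using k j m by (auto simp: gam_def split: if_splits)
qed

lemma measurable_gt_array:
  assumes "k \<le> Suc n"
  shows "(\<lambda>t. gt_array n z eps t k j) \<in> borel_measurable (Pi\<^sub>M (gt_indices n) (\<lambda>_. lborel))"
proof (cases "1 \<le> j \<and> j \<le> k \<and> k \<noteq> Suc n")
  case True
  then have "(k, j) \<in> gt_indices n" using assms by auto
  then have [measurable]: "(\<lambda>t. t (k, j)) \<in> borel_measurable (Pi\<^sub>M (gt_indices n) (\<lambda>_. lborel))"
    using measurable_component_singleton[of "(k, j)" "gt_indices n" "\<lambda>_. lborel"] by simp
  have "(\<lambda>t. complex_of_real (t (k, j)) - \<i> * of_real (eps k j)) \<in> borel_measurable (Pi\<^sub>M (gt_indices n) (\<lambda>_. lborel))"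
    by measurable
  then show ?thesis using True by (simp add: gt_array_def not_less)
next
  case False
  then have const: "(\<lambda>t. gt_array n z eps t k j) = (\<lambda>_. gt_array n z eps (\<lambda>_. 0) k j)"
    by (auto simp: gt_array_def)
  show ?thesis unfolding const by (rule borel_measurable_const)
qed

text \<open>
  The imaginary parts of the variables are fixed, so a change of \<open>x\<close> changes the absolute value of
  the integrand only by a constant factor.
\<close>

lemma integrable_Psi0_integrand_independent_of_x:
  assumes "integrable (Pi\<^sub>M (gt_indices n) (\<lambda>_. lborel)) (\<lambda>t. Psi0_integrand n x (gt_array n z eps t))"
  shows "integrable (Pi\<^sub>M (gt_indices n) (\<lambda>_. lborel)) (\<lambda>t. Psi0_integrand n y (gt_array n z eps t))"
proof -
  let ?M = "Pi\<^sub>M (gt_indices n) (\<lambda>_. lborel :: real measure)"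
  define S where "S t = (\<Sum>k=1..n+1. \<Sum>j=1..k. (gt_array n z eps t k j - gt_array n z eps t (k-1) j) * of_real (y k - x k))" for t
  have S: "Psi0_integrand n y (gt_array n z eps t) = exp (\<i> * S t) * Psi0_integrand n x (gt_array n z eps t)" for t
  proof -
    have "(\<Sum>k=1..n+1. \<Sum>j=1..k. (gt_array n z eps t k j - gt_array n z eps t (k-1) j) * of_real (y k)) =
      S t + (\<Sum>k=1..n+1. \<Sum>j=1..k. (gt_array n z eps t k j - gt_array n z eps t (k-1) j) * of_real (x k))"
      unfolding S_def sum.distrib[symmetric] by (intro sum.cong refl) (simp add: algebra_simps)
    then show ?thesis
      unfolding Psi0_integrand_def by (simp only: ring_distribs(1)[of \<i>] exp_add mult_ac)
  qed
  \<comment> \<open>Only the real parts of the array depend on \<open>t\<close>.\<close>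
  have Im_S: "Im (S t) = Im (S (\<lambda>_. 0))" for t
    unfolding S_def Im_sum
    by (intro sum.cong refl) (simp add: gt_array_def)
  have "S \<in> borel_measurable ?M"
    unfolding S_def
    by (intro borel_measurable_sum borel_measurable_times borel_measurable_diff borel_measurable_const measurable_gt_array) auto
  then have meas: "(\<lambda>t. exp (\<i> * S t)) \<in> borel_measurable ?M"
    by measurable
  have "integrable ?M (\<lambda>t. exp (- Im (S (\<lambda>_. 0))) *\<^sub>R Psi0_integrand n x (gt_array n z eps t))"
    using assms by (rule integrable_scaleR_right)
  then show ?thesis
  proof (rule Bochner_Integration.integrable_bound)
    show "(\<lambda>t. Psi0_integrand n y (gt_array n z eps t)) \<in> borel_measurable ?M"
      unfolding S by (intro borel_measurable_times meas borel_measurable_integrable[OF assms])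
    show "AE t in ?M. norm (Psi0_integrand n y (gt_array n z eps t)) \<le>
        norm (exp (- Im (S (\<lambda>_. 0))) *\<^sub>R Psi0_integrand n x (gt_array n z eps t))"
    proof (intro AE_I2)
      fix t
      have "norm (exp (\<i> * S t)) = exp (- Im (S (\<lambda>_. 0)))"
        using Im_S[of t] by simp
      then show "norm (Psi0_integrand n y (gt_array n z eps t)) \<le>
        norm (exp (- Im (S (\<lambda>_. 0))) *\<^sub>R Psi0_integrand n x (gt_array n z eps t))"
        unfolding S norm_mult by simp
    qed
  qed
qed

text \<open>
  By the previous lemma the integral converges absolutely for every \<open>x\<close> or for none. In the second
  case its value is the default 0 for every \<open>x\<close>, which the constant \<open>c = 0\<close> accounts for.
\<close>

lemma Psi0_eq_exp_dd_det:
  assumes "admissible l lam eps"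
  shows "\<exists>c. \<forall>x. Psi0 l eps lam x =
    c * (if x \<in> weyl_chamber (l + 1) then exp_dd_det (l + 1) (\<lambda>j. of_real (lam j)) x else 0)"
proof -
  let ?M = "Pi\<^sub>M (gt_indices l) (\<lambda>_. lborel :: real measure)" and ?z = "\<lambda>j. complex_of_real (lam j)"
  let ?f = "\<lambda>x t. Psi0_integrand l x (gt_array l ?z eps t)"
  obtain a where a: "\<And>x. Psi0 l eps lam x = a * (\<integral>t. ?f x t \<partial>?M)"
  proof
    fix x
    show "Psi0 l eps lam x = (\<i> powi (- int (l * (l + 1) div 2)) * (\<Prod>n=1..l. \<Prod>j=1..n. 1 / (2 * of_real pi * \<i>))) * (\<integral>t. ?f x t \<partial>?M)"
      unfolding Psi0_def gam_eq_gt_array integral_mult_left_zero by (simp only: mult_ac)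
  qed
  show ?thesis
  proof (cases "\<exists>x. integrable ?M (?f x)")
    case True
    then have int: "integrable ?M (?f x)" for x
      using integrable_Psi0_integrand_independent_of_x by blast
    from integral_Psi0_integrand[of l] obtain c where
      "(\<integral>t. ?f x t \<partial>?M) = c * (if x \<in> weyl_chamber (l + 1) then exp_dd_det (l + 1) ?z x else 0)" for x
      using admissible_imp_heights_below[OF assms] int by blast
    then show ?thesis
      unfolding a by (intro exI[of _ "a * c"]) (simp only: mult.assoc simp_thms)
  next
    case False
    then have "(\<integral>t. ?f x t \<partial>?M) = 0" for x
      by (intro not_integrable_integral_eq) blast
    then show ?thesis
      unfolding a by (intro exI[of _ 0]) simp
  qed
qed

section \<open>The Baxter operator\<close>

text \<open>
  The step functions confine each \<open>y\<^sub>b\<close> to an interval of its own, so the kernel is a product of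
  functions of one variable. The first coordinate has no upper bound.
\<close>

lemma Q0_eq_prod:
  "Q0 l x y s = (\<Prod>b<Suc l.
     (if x (Suc b) \<le> y (Suc b) \<and> (b = 0 \<or> y (Suc b) \<le> x b) then 1 else 0) *
     exp (\<i> * s * of_real (x (Suc b) - y (Suc b))))"
proof -
  let ?p = "\<lambda>b. complex_of_real (Theta (y (Suc b) - x (Suc b)))"
  let ?q = "\<lambda>b. complex_of_real (Theta (x (Suc b) - y (Suc (Suc b))))"
  let ?e = "\<lambda>b. exp (\<i> * s * of_real (x (Suc b) - y (Suc b)))"
  have "exp (\<i> * s * (\<Sum>j=1..l+1. of_real (x j - y j))) = (\<Prod>b<Suc l. ?e b)"
  proof -
    have "(\<Sum>j=1..l+1. complex_of_real (x j - y j)) = (\<Sum>b<Suc l. of_real (x (Suc b) - y (Suc b)))"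
      by (rule sum.reindex_bij_witness[of _ Suc "\<lambda>s. s - 1"]) auto
    then show ?thesis
      unfolding exp_sum[symmetric, OF finite_lessThan] by (simp only: sum_distrib_left)
  qed
  moreover have "(\<Prod>j=1..l. of_real (Theta (y j - x j)) * of_real (Theta (x j - y (j+1)))) =
      (\<Prod>b<l. ?p b) * (\<Prod>b<l. ?q b)"
    unfolding prod.distrib[symmetric]
    by (rule prod.reindex_bij_witness[of _ Suc "\<lambda>s. s - 1"]) auto
  ultimately have "Q0 l x y s = (\<Prod>b<Suc l. ?e b) * (\<Prod>b<Suc l. ?p b) * (\<Prod>b<l. ?q b)"
    unfolding Q0_def by simp
  also have "(\<Prod>b<l. ?q b) = (\<Prod>b<Suc l. if b = 0 then 1 else ?q (b - 1))"
    unfolding prod.lessThan_Suc_shift by simp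
  also have "(\<Prod>b<Suc l. ?e b) * (\<Prod>b<Suc l. ?p b) * (\<Prod>b<Suc l. if b = 0 then 1 else ?q (b - 1)) =
     (\<Prod>b<Suc l. ?e b * ?p b * (if b = 0 then 1 else ?q (b - 1)))"
    by (simp only: prod.distrib)
  also have "\<dots> = (\<Prod>b<Suc l.
     (if x (Suc b) \<le> y (Suc b) \<and> (b = 0 \<or> y (Suc b) \<le> x b) then 1 else 0) * ?e b)"
    by (intro prod.cong refl) (auto simp: Theta_def)
  finally show ?thesis .
qed

lemma Q0_nonzero_imp_weyl_chamber:
  assumes "Q0 l x y s \<noteq> 0"
  shows "y \<in> weyl_chamber (l + 1)"
proof -
  have *: "x (Suc b) \<le> y (Suc b) \<and> (b = 0 \<or> y (Suc b) \<le> x b)" if "b < Suc l" for b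
    using assms that unfolding Q0_eq_prod by (auto simp del: prod.lessThan_Suc split: if_splits)
  show ?thesis
    unfolding weyl_chamber_def
  proof (intro CollectI allI impI)
    fix b assume b: "1 \<le> b \<and> b < l + 1"
    then obtain a where "b = Suc a" "a < l" by (cases b) auto
    with *[of b] *[of a] show "y (Suc b) \<le> y b" by auto
  qed
qed

text \<open>
  Row by row, \<open>exp_dd_tail_rec\<close> is multiplication by a triangular matrix with diagonal \<open>\<i> (s - w j)\<close>.
  This is where the eigenvalue comes from.
\<close>

lemma detf_exp_dd_tail:
  assumes "\<And>j. j < N \<Longrightarrow> Im s < Im (w j)"
  shows "(\<Prod>b<N. exp (- \<i> * s * of_real (X b))) * detf N (\<lambda>b j. exp_dd w j (X b)) =
    detf N (\<lambda>b j. exp_dd_tail w s j (X b)) * (\<Prod>j<N. \<i> * (s - w j))"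
proof -
  let ?U = "\<lambda>k j. if k = j then \<i> * (s - w j) else if Suc k = j then - 1 else 0"
  have "(\<Prod>b<N. exp (- \<i> * s * of_real (X b))) * detf N (\<lambda>b j. exp_dd w j (X b)) =
      detf N (\<lambda>b j. exp (- \<i> * s * of_real (X b)) * exp_dd w j (X b) * 1)"
    unfolding detf_scale by simp
  also have "\<dots> = detf N (\<lambda>b j. \<Sum>k<N. exp_dd_tail w s k (X b) * ?U k j)"
  proof (rule detf_cong)
    fix b j assume j: "j < N"
    have "(\<Sum>k<N. exp_dd_tail w s k (X b) * ?U k j) =
      (\<Sum>k<N. (if k = j then \<i> * (s - w j) * exp_dd_tail w s j (X b) else 0) +
         (if k = j - 1 then if j = 0 then 0 else - exp_dd_tail w s (j - 1) (X b) else 0))"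
      by (intro sum.cong refl) auto
    also have "\<dots> = \<i> * (s - w j) * exp_dd_tail w s j (X b) - (if j = 0 then 0 else exp_dd_tail w s (j - 1) (X b))"
      using j by (simp add: sum.distrib sum.delta less_imp_diff_less)
    also have "\<dots> = exp (- \<i> * s * of_real (X b)) * exp_dd w j (X b)"
      by (rule exp_dd_tail_rec[symmetric]) (use assms j in simp)
    finally show "exp (- \<i> * s * of_real (X b)) * exp_dd w j (X b) * 1 = (\<Sum>k<N. exp_dd_tail w s k (X b) * ?U k j)"
      by simp
  qed
  also have "\<dots> = detf N (\<lambda>b k. exp_dd_tail w s k (X b)) * detf N ?U"
    by (rule detf_mult[symmetric])
  also have "detf N ?U = (\<Prod>j<N. ?U j j)"
    by (rule detf_upper_triangular) auto
  finally show ?thesis by simp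
qed

lemma detf_row_differences:
  "detf N (\<lambda>b j. G b j - (if b = 0 then 0 else G (b - 1) j)) = detf N G"
proof -
  let ?L = "\<lambda>b k. if k = b then 1 else if Suc k = b then - 1 else 0 :: complex"
  have "detf N (\<lambda>b j. G b j - (if b = 0 then 0 else G (b - 1) j)) = detf N (\<lambda>b j. \<Sum>k<N. ?L b k * G k j)"
  proof (rule detf_cong)
    fix b j assume b: "b < N"
    have "(\<Sum>k<N. ?L b k * G k j) =
      (\<Sum>k<N. (if k = b then G b j else 0) + (if k = b - 1 then if b = 0 then 0 else - G (b - 1) j else 0))"
      by (intro sum.cong refl) auto
    also have "\<dots> = G b j - (if b = 0 then 0 else G (b - 1) j)"
      using b by (simp add: sum.distrib sum.delta less_imp_diff_less)
    finally show "G b j - (if b = 0 then 0 else G (b - 1) j) = (\<Sum>k<N. ?L b k * G k j)" ..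
  qed
  also have "\<dots> = detf N ?L * detf N G"
    by (rule detf_mult[symmetric])
  also have "detf N ?L = 1"
    by (subst detf_lower_triangular) auto
  finally show ?thesis by simp
qed

lemma set_integral_exp_dd_interval:
  assumes "\<And>m. m \<le> j \<Longrightarrow> Im s < Im (w m)" and "a \<le> b"
  shows "(LINT u:{a..b}|lborel. exp (- \<i> * s * of_real u) * exp_dd w j u) = exp_dd_tail w s j a - exp_dd_tail w s j b"
proof -
  let ?f = "\<lambda>u. exp (- \<i> * s * of_real u) * exp_dd w j u"
  have I: "set_integrable lborel {x..} ?f" for x
    by (rule set_integrable_exp_dd[OF assms(1)])
  have "(LINT u:{a..<b} \<union> {b..}|lborel. ?f u) = (LINT u:{a..<b}|lborel. ?f u) + (LINT u:{b..}|lborel. ?f u)"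
    by (rule set_integral_Un[OF _ set_integrable_subset[OF I[of a]] I]) auto
  moreover have "{a..<b} \<union> {b..} = {a..}" using assms(2) by auto
  moreover have "(LINT u:{a..<b}|lborel. ?f u) = (LINT u:{a..b}|lborel. ?f u)"
  proof (rule set_integral_cong_set)
    have "continuous_on UNIV ?f" by (intro continuous_intros continuous_exp_dd)
    note [measurable] = borel_measurable_continuous_onI[OF this]
    show "set_borel_measurable lborel {a..<b} ?f" "set_borel_measurable lborel {a..b} ?f"
      unfolding set_borel_measurable_def by measurable
    show "AE u in lborel. (u \<in> {a..b}) = (u \<in> {a..<b})"
      using AE_lborel_singleton[of b] by eventually_elim auto
  qed
  ultimately show ?thesis by (simp add: exp_dd_tail_def del: exp_dd.simps)
qed

text \<open>
  The integral of the determinant is the determinant of the integrals over the single intervals,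
  each a difference of two tails taken at neighbouring coordinates of \<open>x\<close>. Row operations remove
  the differences, and the remaining determinant of tails is the one evaluated above. Outside the
  Weyl chamber one of the intervals is empty and both sides vanish.
\<close>

lemma baxter_integral_exp_dd_det:
  assumes s: "\<And>j. Im s < Im (z j)"
  shows "has_bochner_integral (Pi\<^sub>M {1..l+1} (\<lambda>_. lborel))
    (\<lambda>y. Q0 l x y s * (if y \<in> weyl_chamber (l + 1) then exp_dd_det (l + 1) z y else 0))
    ((\<Prod>j<Suc l. 1 / (\<i> * (s - z (Suc j)))) * (if x \<in> weyl_chamber (l + 1) then exp_dd_det (l + 1) z x else 0))"
proof -
  define w where "w j = z (Suc j)" for j
  have sw: "Im s < Im (w j)" for j using s by (simp add: w_def)
  define X where "X b = x (Suc b)" for b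
  define J where "J b = {u. X b \<le> u \<and> (b = 0 \<or> u \<le> x b)}" for b
  define F where "F b j u = exp (\<i> * s * of_real (X b)) * (indicator (J b) u *\<^sub>R (exp (- \<i> * s * of_real u) * exp_dd w j u))" for b j u
  have Q: "Q0 l x y s * (if y \<in> weyl_chamber (l + 1) then exp_dd_det (l + 1) z y else 0) =
     detf (Suc l) (\<lambda>b j. F b j (y (Suc b)))" for y
  proof -
    let ?A = "\<lambda>b. (if x (Suc b) \<le> y (Suc b) \<and> (b = 0 \<or> y (Suc b) \<le> x b) then 1 else 0) *
        exp (\<i> * s * of_real (x (Suc b) - y (Suc b)))"
    have "Q0 l x y s * (if y \<in> weyl_chamber (l + 1) then exp_dd_det (l + 1) z y else 0) = Q0 l x y s * exp_dd_det (Suc l) z y"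
      using Q0_nonzero_imp_weyl_chamber[of l x y s] by auto
    also have "\<dots> = detf (Suc l) (\<lambda>b j. ?A b * exp_dd w j (y (Suc b)) * 1)"
      unfolding detf_scale Q0_eq_prod exp_dd_det_def w_def[abs_def] by simp
    also have "\<dots> = detf (Suc l) (\<lambda>b j. F b j (y (Suc b)))"
    proof (rule detf_cong)
      fix b j
      have "exp (\<i> * s * of_real (x (Suc b) - y (Suc b))) = exp (\<i> * s * of_real (X b)) * exp (- \<i> * s * of_real (y (Suc b)))"
        unfolding exp_add[symmetric] X_def by (simp add: algebra_simps)
      then show "?A b * exp_dd w j (y (Suc b)) * 1 = F b j (y (Suc b))"
        by (simp add: F_def J_def X_def indicator_def del: exp_dd.simps)
    qed
    finally show ?thesis .
  qed
  have Fint: "integrable lborel (F b j)" for b j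
  proof -
    have "set_integrable lborel (J b) (\<lambda>u. exp (- \<i> * s * of_real u) * exp_dd w j u)"
    proof (rule set_integrable_subset[OF set_integrable_exp_dd[OF sw]])
      show "J b \<in> sets lborel"
      proof (cases "b = 0")
        case True
        then have "J b = {X b..}" by (auto simp: J_def)
        then show ?thesis by simp
      next
        case False
        then have "J b = {X b..x b}" by (auto simp: J_def)
        then show ?thesis by simp
      qed
      show "J b \<subseteq> {X b..}" by (auto simp: J_def)
    qed
    then show ?thesis unfolding F_def set_integrable_def by (rule integrable_mult_right)
  qed
  have bij: "bij_betw Suc {..<Suc l} {1..l+1}"
    by (rule bij_betwI[of _ _ _ "\<lambda>q. q - 1"]) auto
  have main: "has_bochner_integral (Pi\<^sub>M {1..l+1} (\<lambda>_. lborel))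
    (\<lambda>y. Q0 l x y s * (if y \<in> weyl_chamber (l + 1) then exp_dd_det (l + 1) z y else 0))
    (detf (Suc l) (\<lambda>b j. \<integral>u. F b j u \<partial>lborel))"
    unfolding Q by (rule detf_integral[OF bij Fint])
  have Fval: "(\<integral>u. F b j u \<partial>lborel) = exp (\<i> * s * of_real (X b)) * (LINT u:J b|lborel. exp (- \<i> * s * of_real u) * exp_dd w j u)" for b j
    unfolding F_def set_lebesgue_integral_def by (rule integral_mult_right_zero)
  have "detf (Suc l) (\<lambda>b j. \<integral>u. F b j u \<partial>lborel) =
     (\<Prod>j<Suc l. 1 / (\<i> * (s - w j))) * (if x \<in> weyl_chamber (l + 1) then exp_dd_det (l + 1) z x else 0)"
  proof (cases "x \<in> weyl_chamber (l + 1)")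
    case True
    have "detf (Suc l) (\<lambda>b j. \<integral>u. F b j u \<partial>lborel) =
      detf (Suc l) (\<lambda>b j. exp (\<i> * s * of_real (X b)) * (exp_dd_tail w s j (X b) - (if b = 0 then 0 else exp_dd_tail w s j (X (b - 1)))) * 1)"
    proof (rule detf_cong)
      fix b j assume b: "b < Suc l"
      have "(LINT u:J b|lborel. exp (- \<i> * s * of_real u) * exp_dd w j u) = exp_dd_tail w s j (X b) - (if b = 0 then 0 else exp_dd_tail w s j (X (b - 1)))"
      proof (cases "b = 0")
        case True
        then have "J b = {X b..}" by (auto simp: J_def)
        then show ?thesis using True by (simp add: exp_dd_tail_def)
      next
        case False
        then have "J b = {X b..X (b - 1)}" by (auto simp: J_def X_def)
        moreover have "X b \<le> X (b - 1)"
          using \<open>x \<in> weyl_chamber (l + 1)\<close> b False by (simp add: weyl_chamber_def X_def)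
        ultimately show ?thesis
          using set_integral_exp_dd_interval[of j s w "X b" "X (b - 1)"] sw False by simp
      qed
      then show "(\<integral>u. F b j u \<partial>lborel) =
          exp (\<i> * s * of_real (X b)) * (exp_dd_tail w s j (X b) - (if b = 0 then 0 else exp_dd_tail w s j (X (b - 1)))) * 1"
        unfolding Fval by simp
    qed
    also have "\<dots> = (\<Prod>b<Suc l. exp (\<i> * s * of_real (X b))) * detf (Suc l) (\<lambda>b j. exp_dd_tail w s j (X b))"
      unfolding detf_scale detf_row_differences[of "Suc l" "\<lambda>b j. exp_dd_tail w s j (X b)"] by simp
    also have "detf (Suc l) (\<lambda>b j. exp_dd_tail w s j (X b)) =
        (\<Prod>j<Suc l. 1 / (\<i> * (s - w j))) * ((\<Prod>b<Suc l. exp (- \<i> * s * of_real (X b))) * exp_dd_det (Suc l) z x)"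
    proof -
      have "s \<noteq> w j" for j using sw[of j] by auto
      then have "(\<Prod>j<Suc l. 1 / (\<i> * (s - w j))) * (\<Prod>j<Suc l. \<i> * (s - w j)) = 1"
        unfolding prod.distrib[symmetric] by (intro prod.neutral) auto
      moreover have "(\<Prod>b<Suc l. exp (- \<i> * s * of_real (X b))) * exp_dd_det (Suc l) z x =
          detf (Suc l) (\<lambda>b j. exp_dd_tail w s j (X b)) * (\<Prod>j<Suc l. \<i> * (s - w j))"
        using detf_exp_dd_tail[of "Suc l" s w X] sw unfolding exp_dd_det_def X_def w_def[abs_def] by simp
      ultimately show ?thesis by (simp only: mult.left_commute mult_1_right)
    qed
    also have "(\<Prod>b<Suc l. exp (\<i> * s * of_real (X b))) *
        ((\<Prod>j<Suc l. 1 / (\<i> * (s - w j))) * ((\<Prod>b<Suc l. exp (- \<i> * s * of_real (X b))) * exp_dd_det (Suc l) z x)) =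
        (\<Prod>j<Suc l. 1 / (\<i> * (s - w j))) * exp_dd_det (Suc l) z x"
    proof -
      have "(\<Prod>b<Suc l. exp (\<i> * s * of_real (X b))) * (\<Prod>b<Suc l. exp (- \<i> * s * of_real (X b))) = 1"
        unfolding prod.distrib[symmetric] exp_add[symmetric] by (intro prod.neutral) simp
      then have "E * (P * (E' * D)) = P * D"
        if "E = (\<Prod>b<Suc l. exp (\<i> * s * of_real (X b)))" "E' = (\<Prod>b<Suc l. exp (- \<i> * s * of_real (X b)))" for E E' P D
        using that by (metis (no_types) mult.assoc mult.left_commute mult_1)
      then show ?thesis by blast
    qed
    finally show ?thesis using True by simp
  next
    case False
    then obtain b where b: "1 \<le> b" "b < l + 1" "x b < x (Suc b)"
      by (auto simp: weyl_chamber_def not_le)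
    then have "J b = {}" by (auto simp: J_def X_def)
    then have "(\<integral>u. F b j u \<partial>lborel) = 0" for j
      unfolding Fval set_lebesgue_integral_def by simp
    then have "detf (Suc l) (\<lambda>b j. \<integral>u. F b j u \<partial>lborel) = 0"
      using b by (intro detf_zero_row[of b]) auto
    with False show ?thesis by simp
  qed
  with main show ?thesis unfolding w_def by simp
qed

theorem corollary3p2:
  fixes l :: nat and lam x :: "nat \<Rightarrow> real" and s :: complex
    and eps :: "nat \<Rightarrow> nat \<Rightarrow> real"
  assumes "1 \<le> l" and "Im s < 0" and "admissible l lam eps"
  shows "integrable (\<Pi>\<^sub>M j\<in>{1..l+1}. lborel) (\<lambda>y. Q0 l x y s * Psi0 l eps lam y) \<and>
    \<i> ^ (l + 1) * (\<integral>y. Q0 l x y s * Psi0 l eps lam y \<partial>(\<Pi>\<^sub>M j\<in>{1..l+1}. lborel))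
      = L0 l s lam * Psi0 l eps lam x"
proof -
  let ?z = "\<lambda>j. complex_of_real (lam j)"
  let ?D = "\<lambda>y. if y \<in> weyl_chamber (l + 1) then exp_dd_det (l + 1) ?z y else 0"
  obtain c where c: "\<And>y. Psi0 l eps lam y = c * ?D y"
    using Psi0_eq_exp_dd_det[OF assms(3)] by blast
  let ?p = "\<Prod>j<Suc l. 1 / (\<i> * (s - ?z (Suc j)))"
  have "has_bochner_integral (Pi\<^sub>M {1..l+1} (\<lambda>_. lborel)) (\<lambda>y. c * (Q0 l x y s * ?D y)) (c * (?p * ?D x))"
    by (intro has_bochner_integral_mult_right baxter_integral_exp_dd_det) (use assms(2) in simp)
  then have B: "has_bochner_integral (Pi\<^sub>M {1..l+1} (\<lambda>_. lborel)) (\<lambda>y. Q0 l x y s * Psi0 l eps lam y) (?p * Psi0 l eps lam x)"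
    unfolding c by (simp only: mult.left_commute[of c])
  have "\<i> ^ (l + 1) * ?p = L0 l s lam"
  proof -
    have "L0 l s lam = (\<Prod>j<Suc l. 1 / (s - ?z (Suc j)))"
      unfolding L0_def by (rule prod.reindex_bij_witness[of _ Suc "\<lambda>s. s - 1"]) auto
    moreover have "\<i> ^ (l + 1) * ?p = (\<Prod>j<Suc l. \<i> * (1 / (\<i> * (s - ?z (Suc j)))))"
      unfolding prod.distrib prod_constant by simp
    moreover have "\<i> * (1 / (\<i> * (s - ?z (Suc j)))) = 1 / (s - ?z (Suc j))" for j
      by simp
    ultimately show ?thesis by (simp only:)
  qed
  then show ?thesis
    using B unfolding has_bochner_integral_iff by (simp only: mult.assoc[symmetric] simp_thms)
qed

end
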